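(* The problem of designing the minimum cost interventions to learn a causal graph can be solved in polynomial time. That is, given a chordal graph $G=(V,E)$ and a cost function $w:V\to\mathbb{R}$ on its vertices, an intervention design of minimum total cost among all intervention designs (with no bound on the number of interventions) that learn every causal graph with skeleton $G$ can be constructed in polynomial time.
   Context: All graphs are finite. A causal graph is a directed acyclic graph (DAG) $D$. The skeleton of $D$ is the undirected graph obtained by forgetting edge directions. An immorality of $D$ is an induced subgraph of the form $X\to Z\leftarrow Y$ with $X,Y$ non-adjacent. An intervention design for an undirected graph $G=(V,E)$ is a finite collection $\mathcal{I}=\{I_1,\dots,I_m\}$ of subsets of $V$ ($I_i$ is the set of vertices intervened on in the $i$-th experiment), fixed in advance (non-adaptively). Given the skeleton and the immoralities of $D$, intervening on $I_i$ reveals the direction in $D$ of every edge with exactly one endpoint in $I_i$, after which the (complete) Meek rules orient every further edge whose direction is forced. Thus $\mathcal{I}$ learns the causal graph $D$ with skeleton $G$ if $D$ is the only DAG with skeleton $G$ that has the same immoralities as $D$ and that agrees with $D$ on the direction of every edge having, for some $i$, exactly one endpoint in $I_i$. $\mathcal{I}$ learns every causal graph with skeleton $G$ if this holds for every DAG $D$ with skeleton $G$. The cost of intervening on a set $I\subseteq V$ is $\sum_{j\in I}w_j$, and the total cost of $\mathcal{I}$ is $\sum_{i=1}^m\sum_{j\in I_i}w_j$.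
   Formalization: If some vertex has negative cost, repeating its intervention makes the total cost unbounded below, so no minimum cost design exists. The formal claim is that the algorithm outputs one whenever one exists (always when all costs are nonnegative) and otherwise reports that there is none. *)

theory Defs
  imports Complex_Main "HOL-Computational_Algebra.Polynomial"
begin

section \<open>Undirected graphs and causal graphs\<close>

definition simple_graph :: "'a set \<Rightarrow> 'a set set \<Rightarrow> bool" where
  "simple_graph V E \<longleftrightarrow> finite V \<and> (\<forall>e\<in>E. e \<subseteq> V \<and> card e = 2)"

definition cycle :: "'a set set \<Rightarrow> 'a list \<Rightarrow> bool" where
  "cycle E vs \<longleftrightarrow> 3 \<le> length vs \<and> distinct vs \<and>
     (\<forall>i < length vs. {vs ! i, vs ! (Suc i mod length vs)} \<in> E)"

definition has_chord :: "'a set set \<Rightarrow> 'a list \<Rightarrow> bool" where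
  "has_chord E vs \<longleftrightarrow>
     (\<exists>i j. i < j \<and> j < length vs \<and> {vs ! i, vs ! j} \<in> E \<and>
            j \<noteq> Suc i \<and> \<not> (i = 0 \<and> Suc j = length vs))"

definition chordal :: "'a set set \<Rightarrow> bool" where
  "chordal E \<longleftrightarrow> (\<forall>vs. cycle E vs \<and> 4 \<le> length vs \<longrightarrow> has_chord E vs)"

definition skeleton :: "('a \<times> 'a) set \<Rightarrow> 'a set set" where
  "skeleton D = {{x, y} | x y. (x, y) \<in> D}"

definition causal_graph :: "'a set \<Rightarrow> 'a set set \<Rightarrow> ('a \<times> 'a) set \<Rightarrow> bool" where
  "causal_graph V E D \<longleftrightarrow> D \<subseteq> V \<times> V \<and> acyclic D \<and> skeleton D = E"

text \<open>The triple \<open>(x, z, y)\<close> stands for the induced subgraph \<open>x \<rightarrow> z \<leftarrow> y\<close>.\<close>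

definition immoralities :: "('a \<times> 'a) set \<Rightarrow> ('a \<times> 'a \<times> 'a) set" where
  "immoralities D = {(x, z, y). (x, z) \<in> D \<and> (y, z) \<in> D \<and> x \<noteq> y \<and> {x, y} \<notin> skeleton D}"

section \<open>Intervention designs\<close>

text \<open>A design is an indexed family \<open>I\<^sub>1, \<dots>, I\<^sub>m\<close>, represented as a list of vertex sets;
  its cost is the indexed sum, so a repeated experiment is paid for again.\<close>

definition intervention_design :: "'a set \<Rightarrow> 'a set list \<Rightarrow> bool" where
  "intervention_design V Is \<longleftrightarrow> (\<forall>I\<in>set Is. I \<subseteq> V)"

definition learns :: "'a set \<Rightarrow> 'a set set \<Rightarrow> 'a set list \<Rightarrow> ('a \<times> 'a) set \<Rightarrow> bool" where
  "learns V E Is D \<longleftrightarrow>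
     (\<forall>D'. causal_graph V E D' \<and> immoralities D' = immoralities D \<and>
           (\<forall>x y. {x, y} \<in> E \<and> (\<exists>I\<in>set Is. (x \<in> I) \<noteq> (y \<in> I))
                  \<longrightarrow> ((x, y) \<in> D' \<longleftrightarrow> (x, y) \<in> D))
           \<longrightarrow> D' = D)"

definition learns_every :: "'a set \<Rightarrow> 'a set set \<Rightarrow> 'a set list \<Rightarrow> bool" where
  "learns_every V E Is \<longleftrightarrow> (\<forall>D. causal_graph V E D \<longrightarrow> learns V E Is D)"

definition design_cost :: "('a \<Rightarrow> real) \<Rightarrow> 'a set list \<Rightarrow> real" where
  "design_cost w Is = (\<Sum>I\<leftarrow>Is. \<Sum>j\<in>I. w j)"

definition min_cost_design ::
  "'a set \<Rightarrow> 'a set set \<Rightarrow> ('a \<Rightarrow> real) \<Rightarrow> 'a set list \<Rightarrow> bool" where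
  "min_cost_design V E w Is \<longleftrightarrow>
     intervention_design V Is \<and> learns_every V E Is \<and>
     (\<forall>Js. intervention_design V Js \<and> learns_every V E Js \<longrightarrow> design_cost w Is \<le> design_cost w Js)"

section \<open>A real random access machine\<close>

text \<open>
  Programs act on unbounded arrays of natural numbers and of reals. Arrays are named by numerals
  occurring in the program, so a program uses finitely many of them; array indices are computed.
  The instruction set is kept weak so that counting one unit per executed command is a sound
  measure of time. There is no multiplication: in \<open>t\<close> steps a fixed program can only produce
  numbers of \<open>O(t)\<close> bits more than its input. Real numbers can only be copied, added, subtracted
  and compared; the only real constant is \<open>0\<close>, and there is no conversion from reals to naturals
  other than by comparison. For rational costs, polynomial time on this machine therefore implies
  polynomial time in the bit model. Expressions are charged nothing of their own because the
  expressions of a fixed program have bounded size.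
\<close>

datatype nexp =
    NConst nat
  | NCell nat nexp
  | NAdd nexp nexp
  | NSub nexp nexp

datatype rexp =
    RZero
  | RCell nat nexp
  | RAdd rexp rexp
  | RSub rexp rexp

datatype bexp =
    NLess nexp nexp
  | RLess rexp rexp
  | BNot bexp
  | BAnd bexp bexp

datatype com =
    Skip
  | NAssign nat nexp nexp
  | RAssign nat nexp rexp
  | Output nexp
  | Seq com com
  | If bexp com com
  | While bexp com

record ram_state =
  nmem :: "nat \<Rightarrow> nat \<Rightarrow> nat"
  rmem :: "nat \<Rightarrow> nat \<Rightarrow> real"
  outp :: "nat list"

fun nval :: "nexp \<Rightarrow> ram_state \<Rightarrow> nat" where
  "nval (NConst c) s = c"
| "nval (NCell a i) s = nmem s a (nval i s)"
| "nval (NAdd e f) s = nval e s + nval f s"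
| "nval (NSub e f) s = nval e s - nval f s"

fun rval :: "rexp \<Rightarrow> ram_state \<Rightarrow> real" where
  "rval RZero s = 0"
| "rval (RCell a i) s = rmem s a (nval i s)"
| "rval (RAdd e f) s = rval e s + rval f s"
| "rval (RSub e f) s = rval e s - rval f s"

fun bval :: "bexp \<Rightarrow> ram_state \<Rightarrow> bool" where
  "bval (NLess e f) s = (nval e s < nval f s)"
| "bval (RLess e f) s = (rval e s < rval f s)"
| "bval (BNot b) s = (\<not> bval b s)"
| "bval (BAnd b c) s = (bval b s \<and> bval c s)"

text \<open>\<open>exec c s t s'\<close>: started in \<open>s\<close>, the program \<open>c\<close> halts in \<open>s'\<close> after \<open>t\<close> steps.
  \<open>Output\<close> appends to a write-only output sequence, so the length of the output is at most
  \<open>t\<close>.\<close>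

inductive exec :: "com \<Rightarrow> ram_state \<Rightarrow> nat \<Rightarrow> ram_state \<Rightarrow> bool" where
  Skip: "exec Skip s 1 s"
| NAssign: "exec (NAssign a i e) s 1
     (s\<lparr>nmem := (nmem s)(a := (nmem s a)(nval i s := nval e s))\<rparr>)"
| RAssign: "exec (RAssign a i e) s 1
     (s\<lparr>rmem := (rmem s)(a := (rmem s a)(nval i s := rval e s))\<rparr>)"
| Output: "exec (Output e) s 1 (s\<lparr>outp := outp s @ [nval e s]\<rparr>)"
| Seq: "exec c1 s t1 s1 \<Longrightarrow> exec c2 s1 t2 s2 \<Longrightarrow> exec (Seq c1 c2) s (t1 + t2) s2"
| IfTrue: "bval b s \<Longrightarrow> exec c1 s t s' \<Longrightarrow> exec (If b c1 c2) s (Suc t) s'"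
| IfFalse: "\<not> bval b s \<Longrightarrow> exec c2 s t s' \<Longrightarrow> exec (If b c1 c2) s (Suc t) s'"
| WhileFalse: "\<not> bval b s \<Longrightarrow> exec (While b c) s 1 s"
| WhileTrue: "bval b s \<Longrightarrow> exec c s t1 s1 \<Longrightarrow> exec (While b c) s1 t2 s2 \<Longrightarrow>
     exec (While b c) s (Suc (t1 + t2)) s2"

inductive_cases exec_SkipE: "exec Skip s t s'"
inductive_cases exec_NAssignE: "exec (NAssign a i e) s t s'"
inductive_cases exec_RAssignE: "exec (RAssign a i e) s t s'"
inductive_cases exec_OutputE: "exec (Output e) s t s'"
inductive_cases exec_SeqE: "exec (Seq c1 c2) s t s'"
inductive_cases exec_IfE: "exec (If b c1 c2) s t s'"
inductive_cases exec_WhileE: "exec (While b c) s t s'"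

lemma exec_deterministic:
  "exec c s t s' \<Longrightarrow> exec c s u s'' \<Longrightarrow> u = t \<and> s'' = s'"
proof (induction arbitrary: u s'' rule: exec.induct)
  case (Seq c1 s t1 s1 c2 t2 s2)
  from Seq.prems obtain u1 u2 r where "exec c1 s u1 r" "exec c2 r u2 s''" "u = u1 + u2"
    by (rule exec_SeqE) auto
  with Seq.IH show ?case by metis
next
  case (WhileTrue b s c t1 s1 t2 s2)
  from WhileTrue.prems obtain u1 u2 r
    where "exec c s u1 r" "exec (While b c) r u2 s''" "u = Suc (u1 + u2)"
    by (rule exec_WhileE) (use WhileTrue.hyps(1) in auto)
  with WhileTrue.IH show ?case by metis
next
  case (IfTrue b s c1 t s' c2)
  from IfTrue.prems obtain v where "exec c1 s v s''" "u = Suc v"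
    by (rule exec_IfE) (use IfTrue.hyps(1) in auto)
  with IfTrue.IH show ?case by metis
next
  case (IfFalse b s c2 t s' c1)
  from IfFalse.prems obtain v where "exec c2 s v s''" "u = Suc v"
    by (rule exec_IfE) (use IfFalse.hyps(1) in auto)
  with IfFalse.IH show ?case by metis
next
  case (WhileFalse b s c)
  from WhileFalse.prems show ?case
    by (rule exec_WhileE) (use WhileFalse.hyps(1) in auto)
qed (auto elim: exec_SkipE exec_NAssignE exec_RAssignE exec_OutputE)

section \<open>Encoding of inputs and outputs\<close>

text \<open>A graph on the vertices \<open>0, \<dots>, n - 1\<close> is given by \<open>n\<close> (array 0) and its adjacency matrix
  (array 1, row by row); the costs are in real array 0.\<close>

definition input_state :: "nat \<Rightarrow> nat set set \<Rightarrow> (nat \<Rightarrow> real) \<Rightarrow> ram_state" where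
  "input_state n E w =
     \<lparr> nmem = (\<lambda>a i. if a = 0 \<and> i = 0 then n
                      else if a = 1 \<and> i < n * n \<and> {i div n, i mod n} \<in> E then 1
                      else 0),
       rmem = (\<lambda>a i. if a = 0 \<and> i < n then w i else 0),
       outp = [] \<rparr>"

text \<open>A design is written as the number of interventions, followed by each intervention as the
  number of listed vertices and the vertices. An encoding is never the empty sequence.\<close>

definition encode_design :: "nat list list \<Rightarrow> nat list" where
  "encode_design xss = length xss # concat (map (\<lambda>xs. length xs # xs) xss)"

end

theory Submission
  imports Defs
begin

text \<open>
  A design learns every causal graph on a chordal skeleton iff each edge is separated by some
  experiment: every edge can stand first in a perfect elimination order, and reversing it there
  creates neither a cycle nor an immorality. The vertices that a separating design never
  intervenes on form an independent set, so for nonnegative costs its total cost is at least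
  \<open>w(V) - w(S)\<close> with \<open>S\<close> an independent set of maximum weight, and one singleton experiment for
  each vertex outside \<open>S\<close> attains this bound. On chordal graphs Frank's algorithm finds \<open>S\<close>: it
  eliminates simplicial vertices, subtracting the residual weight of each from its remaining
  neighbours, and then selects greedily in reverse order. If some cost is negative, repeating
  that vertex makes the cost unbounded below, and there is no optimal design.
\<close>

section \<open>Chordal graphs\<close>

text \<open>Reversing a single edge is harmless only where no third vertex points into it, so the
  necessity of separation needs an arbitrary edge at the very start of a perfect elimination order.
  Plain existence of a simplicial vertex does not give this: the vertices peeled off from the far
  end must never be an endpoint of the chosen edge. Hence Dirac's theorem is proved in a form that
  avoids a prescribed clique; the edge is that clique, while the algorithm itself uses the empty
  one. Optimality of Frank's set is linear programming duality: positive residuals form a dual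
  solution, and the greedy rule enforces complementary slackness. On the machine side, every loop
  counts up to \<open>n\<close>, so a time bound can be read off the syntax and the correctness
  arguments never mention step counts. Since the machine cannot multiply, the addresses of the
  matrix rows are tabulated by repeated addition.\<close>

definition clique :: "'a set set \<Rightarrow> 'a set \<Rightarrow> bool" where
  "clique E K \<longleftrightarrow> (\<forall>u\<in>K. \<forall>v\<in>K. u \<noteq> v \<longrightarrow> {u, v} \<in> E)"

definition simplicial :: "'a set set \<Rightarrow> 'a set \<Rightarrow> 'a \<Rightarrow> bool" where
  "simplicial E W v \<longleftrightarrow> v \<in> W \<and> clique E {u \<in> W. {v, u} \<in> E}"

lemma edge_neq:
  assumes "\<forall>e\<in>E. card e = 2" "{u, v} \<in> E"
  shows "u \<noteq> v"
  using assms by force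

text \<open>Otherwise a shortest walk from \<open>s\<close> to \<open>t\<close> with interior in
  \<open>B\<close>, closed up through \<open>v\<close>, is a chordless cycle of length at least 4:
  \<open>v\<close> sees only the two ends, and any chord between walk vertices would shorten the
  walk.\<close>

lemma common_neighbours_adjacent:
  assumes chordal: "chordal E" and edges: "\<forall>e\<in>E. card e = 2"
    and st: "s \<noteq> t" "{v, s} \<in> E" "{v, t} \<in> E"
    and B: "v \<notin> B" "\<forall>b\<in>B. {v, b} \<notin> E"
    and ends: "{s, b1} \<in> E" "b1 \<in> B" "{b2, t} \<in> E"
    and path: "(b1, b2) \<in> {(x, y). x \<in> B \<and> y \<in> B \<and> {x, y} \<in> E}\<^sup>*"
  shows "{s, t} \<in> E"
proof (rule ccontr)
  assume nst: "{s, t} \<notin> E"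
  define walk where "walk k p \<longleftrightarrow> p 0 = s \<and> p k = t \<and> (\<forall>i<k. {p i, p (Suc i)} \<in> E)
      \<and> (\<forall>i. 0 < i \<and> i < k \<longrightarrow> p i \<in> B)" for k and p :: "nat \<Rightarrow> 'a"
  have "\<exists>k p. walk k p"
  proof -
    obtain m where "(b1, b2) \<in> {(x, y). x \<in> B \<and> y \<in> B \<and> {x, y} \<in> E} ^^ m"
      using path rtrancl_power by blast
    then obtain f where f: "f 0 = b1" "f m = b2"
        "\<And>i. i < m \<Longrightarrow> f i \<in> B \<and> f (Suc i) \<in> B \<and> {f i, f (Suc i)} \<in> E"
      unfolding relpow_fun_conv by auto
    \<comment> \<open>\<open>f\<close> takes \<open>m\<close> steps from \<open>b1\<close> to
      \<open>b2\<close>; the two extra steps attach \<open>s\<close> and \<open>t\<close>.\<close>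
    define p where "p i = (if i = 0 then s else if i = m + 2 then t else f (i - 1))" for i
    have fB: "f i \<in> B" if "i \<le> m" for i
      using f that ends(2) by (cases i) auto
    have "{p i, p (Suc i)} \<in> E" if i: "i < m + 2" for i
    proof -
      consider "i = 0" | "i = Suc m" | j where "i = Suc j" "j < m"
        using i by (cases i) (auto simp: less_Suc_eq)
      then show ?thesis
        by cases (use f ends in \<open>auto simp: p_def\<close>)
    qed
    then have "walk (m + 2) p"
      using fB by (auto simp: walk_def p_def)
    then show ?thesis by blast
  qed
  then obtain k p where walk: "walk k p" and least: "\<And>l q. l < k \<Longrightarrow> \<not> walk l q"
    using exists_least_iff[of "\<lambda>k. \<exists>p. walk k p"] by metis
  have k: "2 \<le> k"
  proof -
    have "k \<noteq> 0" using walk st(1) by (auto simp: walk_def intro: ccontr)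
    moreover have "k \<noteq> 1" using walk nst by (auto simp: walk_def)
    ultimately show ?thesis by simp
  qed
  have ps: "p 0 = s" "p k = t" and pE: "\<And>i. i < k \<Longrightarrow> {p i, p (Suc i)} \<in> E"
    and pB: "\<And>i. 0 < i \<Longrightarrow> i < k \<Longrightarrow> p i \<in> B"
    using walk by (auto simp: walk_def)
  have inj: "p i \<noteq> p j" if "i < j" "j \<le> k" for i j
  proof
    assume eq: "p i = p j"
    \<comment> \<open>Cutting out the closed detour between positions \<open>i\<close> and
      \<open>j\<close> gives a shorter walk.\<close>
    define q where "q m = (if m \<le> i then p m else p (m + (j - i)))" for m
    have "q (k - (j - i)) = t"
    proof (cases "k - (j - i) \<le> i")
      case True
      then have "k - (j - i) = i" "j = k" using that by auto
      then show ?thesis using eq ps by (simp add: q_def)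
    qed (use that ps in \<open>simp add: q_def\<close>)
    moreover have "{q m, q (Suc m)} \<in> E" if "m < k - (j - i)" for m
    proof (cases "m = i")
      case True
      then show ?thesis using that eq pE[of j] \<open>i < j\<close> by (simp add: q_def)
    next
      case False
      then show ?thesis using that pE[of m] pE[of "m + (j - i)"] by (auto simp: q_def)
    qed
    moreover have "q m \<in> B" if "0 < m" "m < k - (j - i)" for m
      using that pB by (auto simp: q_def)
    ultimately have "walk (k - (j - i)) q"
      using ps by (simp add: walk_def q_def)
    moreover have "k - (j - i) < k" using that by simp
    ultimately show False using least by blast
  qed
  have nochord: "{p i, p j} \<notin> E" if "Suc i < j" "j \<le> k" for i j
  proof
    \<comment> \<open>The chord replaces the stretch from \<open>i\<close> to \<open>j\<close>,
      saving \<open>d\<close> steps.\<close>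
    assume edge: "{p i, p j} \<in> E"
    define d where "d = j - Suc i"
    define q where "q m = (if m \<le> i then p m else p (m + d))" for m
    have "q (k - d) = t"
      using that ps by (auto simp: q_def d_def)
    moreover have "{q m, q (Suc m)} \<in> E" if "m < k - d" for m
    proof (cases "m = i")
      case True
      then show ?thesis using edge \<open>Suc i < j\<close> by (simp add: q_def d_def)
    next
      case False
      then show ?thesis using that pE[of m] pE[of "m + d"] by (auto simp: q_def)
    qed
    moreover have "q m \<in> B" if "0 < m" "m < k - d" for m
      using that pB by (auto simp: q_def)
    ultimately have "walk (k - d) q"
      using ps by (simp add: walk_def q_def)
    moreover have "k - d < k" using that by (simp add: d_def)
    ultimately show False using least by blast
  qed
  have vE: "{v, p i} \<in> E \<longleftrightarrow> i = 0 \<or> i = k" if "i \<le> k" for i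
    using that ps st B pB[of i] by (cases "i = 0 \<or> i = k") auto
  have vp: "v \<noteq> p i" if "i \<le> k" for i
    using that ps st B pB[of i] edge_neq[OF edges] by (cases "i = 0 \<or> i = k") auto
  define vs where "vs = v # map p [0..<Suc k]"
  have len: "length vs = k + 2" by (simp add: vs_def)
  have nth0: "vs ! 0 = v" and nthS: "\<And>i. i \<le> k \<Longrightarrow> vs ! Suc i = p i"
    by (auto simp: vs_def simp del: upt_Suc)
  have "cycle E vs"
    unfolding cycle_def
  proof (intro conjI allI impI)
    show "3 \<le> length vs" using k len by simp
    have "inj_on p {0..<Suc k}"
      by (rule linorder_inj_onI) (use inj in auto)
    moreover have "v \<notin> p ` {0..<Suc k}"
    proof
      assume "v \<in> p ` {0..<Suc k}"
      then obtain i where "i < Suc k" "v = p i" by auto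
      then show False using vp[of i] by simp
    qed
    ultimately show "distinct vs"
      by (simp add: vs_def distinct_map del: upt_Suc)
    fix i assume i: "i < length vs"
    consider "i = 0" | "i = Suc k" | j where "i = Suc j" "j < k"
      using i len by (cases i) (auto simp: less_Suc_eq)
    then show "{vs ! i, vs ! (Suc i mod length vs)} \<in> E"
    proof cases
      case 1
      then show ?thesis using len nth0 nthS[of 0] vE[of 0] by simp
    next
      case 2
      then show ?thesis using len nth0 nthS[of k] vE[of k] by (simp add: insert_commute)
    next
      case 3
      then show ?thesis using len nthS[of j] nthS[of "Suc j"] pE[of j] by simp
    qed
  qed
  then have "has_chord E vs"
    using chordal k len by (simp add: chordal_def)
  then obtain i j where ij: "i < j" "j < k + 2" "{vs ! i, vs ! j} \<in> E" "j \<noteq> Suc i"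
      "\<not> (i = 0 \<and> Suc j = k + 2)"
    unfolding has_chord_def len by blast
  obtain j' where j': "j = Suc j'" using ij by (cases j) auto
  show False
  proof (cases i)
    case 0
    then show False using ij j' nth0 nthS[of j'] vE[of j'] by auto
  next
    case (Suc i')
    then show False using ij j' nthS[of j'] nthS[of i'] nochord[of i' j'] by auto
  qed
qed

text \<open>Dirac's theorem, strengthened to avoid a given clique. In the induction step, \<open>B\<close> is a
  component of the graph left by deleting a vertex \<open>v\<close> and its neighbours; the neighbourhood of
  \<open>B\<close> is a clique because it lies inside that of \<open>v\<close>.\<close>

theorem simplicial_vertex_outside_clique:
  assumes "chordal E" and edges: "\<forall>e\<in>E. card e = 2"
    and "finite W" "clique E K" "K \<subset> W"
  shows "\<exists>x. simplicial E W x \<and> x \<notin> K"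
  using assms(3-5)
proof (induction W arbitrary: K rule: finite_psubset_induct)
  case (psubset W)
  note clique = \<open>clique E K\<close>
  show ?case
  proof (cases "clique E W")
    case True
    then have "simplicial E W x" if "x \<in> W" for x
      using that by (auto simp: simplicial_def clique_def)
    then show ?thesis using psubset.prems by blast
  next
    case False
    define univ where "univ x \<longleftrightarrow> (\<forall>u\<in>W. u \<noteq> x \<longrightarrow> {x, u} \<in> E)" for x
    have "\<exists>v\<in>W. \<not> univ v" using False unfolding univ_def clique_def by metis
    \<comment> \<open>A vertex of \<open>K\<close> is preferred whenever one of them is not
      universal. Either way a non-neighbour of \<open>v\<close> cannot lie in \<open>K\<close>: it
      would have to be adjacent to \<open>v\<close> as a member of the same clique, or as a
      universal vertex.\<close>
    then obtain v where v: "v \<in> W" "\<not> univ v" "v \<in> K \<or> (\<forall>k\<in>K. univ k)"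
      using psubset.prems by blast
    define M where "M = {x \<in> W. x \<noteq> v \<and> {v, x} \<notin> E}"
    obtain b where b: "b \<in> M" using v by (auto simp: M_def univ_def)
    define R where "R = {(x, y). x \<in> M \<and> y \<in> M \<and> {x, y} \<in> E}"
    define B where "B = {x. (b, x) \<in> R\<^sup>*}"
    define S where "S = {u \<in> W. {v, u} \<in> E \<and> (\<exists>b\<in>B. {u, b} \<in> E)}"
    have BM: "B \<subseteq> M"
    proof
      fix x assume "x \<in> B"
      then have "(b, x) \<in> R\<^sup>*" by (simp add: B_def)
      then show "x \<in> M" by induction (use b in \<open>auto simp: R_def\<close>)
    qed
    have bB: "b \<in> B" by (simp add: B_def)
    have Bstep: "y \<in> B" if "x \<in> B" "y \<in> M" "{x, y} \<in> E" for x y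
      using that BM by (auto simp: B_def R_def intro: rtrancl_into_rtrancl)
    \<comment> \<open>Paths in \<open>R\<close> from \<open>b\<close> never leave \<open>B\<close>,
      so they are also paths in the restriction to \<open>B\<close>, which is the form that
      \<open>common_neighbours_adjacent\<close> asks for.\<close>
    define RB where "RB = {(x, y). x \<in> B \<and> y \<in> B \<and> {x, y} \<in> E}"
    have conn: "(b, x) \<in> RB\<^sup>*" if "x \<in> B" for x
    proof -
      have "(b, x) \<in> R\<^sup>*" using that by (simp add: B_def)
      then show ?thesis
      proof induction
        case (step y z)
        then have "y \<in> B" by (simp add: B_def)
        with step have "(y, z) \<in> RB"
          using Bstep[of y z] by (auto simp: RB_def R_def)
        with step show ?case by (meson rtrancl_into_rtrancl)
      qed simp
    qed
    have "sym RB" by (auto simp: sym_def RB_def insert_commute)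
    have conn2: "(x, y) \<in> RB\<^sup>*" if "x \<in> B" "y \<in> B" for x y
      using conn[OF that(1)] conn[OF that(2)] sym_rtrancl[OF \<open>sym RB\<close>]
      by (meson rtrancl_trans symD)
    have "clique E S"
      unfolding clique_def
    proof (intro ballI impI)
      fix s t assume st: "s \<in> S" "t \<in> S" "s \<noteq> t"
      then obtain b1 b2 where "b1 \<in> B" "{s, b1} \<in> E" "b2 \<in> B" "{t, b2} \<in> E"
        by (auto simp: S_def)
      then show "{s, t} \<in> E"
        using common_neighbours_adjacent[OF assms(1) edges, of s t v B b1 b2]
          st conn2[of b1 b2] BM unfolding RB_def
        by (auto simp: S_def M_def insert_commute)
    qed
    have "B \<union> S \<subset> W"
    proof -
      have "v \<notin> B \<union> S" using BM edge_neq[OF edges] by (auto simp: M_def S_def)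
      moreover have "B \<union> S \<subseteq> W" using BM by (auto simp: M_def S_def)
      ultimately show ?thesis using v by blast
    qed
    moreover have "b \<notin> S" using b by (auto simp: S_def M_def)
    \<comment> \<open>Taking \<open>S\<close> as the clique to avoid forces the simplicial vertex
      into \<open>B\<close>.\<close>
    ultimately obtain x where x: "simplicial E (B \<union> S) x" "x \<notin> S"
      using psubset.IH[of "B \<union> S" S] \<open>clique E S\<close> bB by blast
    then have xB: "x \<in> B" by (auto simp: simplicial_def)
    have xv: "x \<in> W" "x \<noteq> v" "{v, x} \<notin> E" using xB BM by (auto simp: M_def)
    \<comment> \<open>A vertex of \<open>B\<close> has all its neighbours in
      \<open>B \<union> S\<close>, so being simplicial there is the same as being simplicial in
      \<open>W\<close>.\<close>
    have "{u \<in> W. {x, u} \<in> E} \<subseteq> {u \<in> B \<union> S. {x, u} \<in> E}"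
    proof safe
      fix u assume u: "u \<in> W" "{x, u} \<in> E" "u \<notin> S"
      have "u \<noteq> v" using u xv by (auto simp: insert_commute)
      moreover have "{v, u} \<notin> E" using u xB by (auto simp: S_def insert_commute)
      ultimately show "u \<in> B" using Bstep[OF xB, of u] u by (simp add: M_def)
    qed
    then have "simplicial E W x"
      using x xv unfolding simplicial_def clique_def by blast
    moreover have "x \<notin> K"
    proof
      assume "x \<in> K"
      from v(3) show False
      proof
        assume "v \<in> K"
        then show False using \<open>x \<in> K\<close> clique xv by (auto simp: clique_def)
      next
        assume "\<forall>k\<in>K. univ k"
        then show False using \<open>x \<in> K\<close> xv v by (auto simp: univ_def insert_commute)
      qed
    qed
    ultimately show ?thesis by blast
  qed
qed

section \<open>Learning and separating\<close>

definition separates :: "'a set set \<Rightarrow> 'a set list \<Rightarrow> bool" where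
  "separates E Is \<longleftrightarrow> (\<forall>x y. {x, y} \<in> E \<longrightarrow> (\<exists>I\<in>set Is. (x \<in> I) \<noteq> (y \<in> I)))"

text \<open>Orienting along a ranking makes acyclicity automatic; injectivity of the ranking ensures
  that every edge gets a direction.\<close>

definition oriented_by :: "'a set set \<Rightarrow> ('a \<Rightarrow> nat) \<Rightarrow> ('a \<times> 'a) set" where
  "oriented_by E f = {(x, y). {x, y} \<in> E \<and> f x < f y}"

lemma skeleton_oriented_by:
  assumes "simple_graph V E" "inj_on f V"
  shows "skeleton (oriented_by E f) = E"
proof
  show "skeleton (oriented_by E f) \<subseteq> E"
    by (auto simp: skeleton_def oriented_by_def)
  show "E \<subseteq> skeleton (oriented_by E f)"
  proof
    fix e assume e: "e \<in> E"
    then obtain x y where xy: "e = {x, y}" "x \<noteq> y"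
      using assms(1) by (auto simp: simple_graph_def card_2_iff)
    moreover have "x \<in> V" "y \<in> V" using e xy assms(1) by (auto simp: simple_graph_def)
    ultimately have "f x < f y \<or> f y < f x"
      using assms(2) by (metis inj_onD linorder_neqE_nat)
    then have "(x, y) \<in> oriented_by E f \<or> (y, x) \<in> oriented_by E f"
      using e xy by (auto simp: oriented_by_def insert_commute)
    moreover have "e = {x, y}" "e = {y, x}" using xy by auto
    ultimately show "e \<in> skeleton (oriented_by E f)"
      unfolding skeleton_def by blast
  qed
qed

lemma causal_graph_oriented_by:
  assumes "simple_graph V E" "inj_on f V"
  shows "causal_graph V E (oriented_by E f)"
proof -
  have "oriented_by E f \<subseteq> measure f" by (auto simp: oriented_by_def)
  then have "acyclic (oriented_by E f)" using wf_acyclic wf_subset wf_measure by metis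
  moreover have "oriented_by E f \<subseteq> V \<times> V"
    using assms(1) by (fastforce simp: simple_graph_def oriented_by_def)
  ultimately show ?thesis
    using skeleton_oriented_by[OF assms] by (simp add: causal_graph_def)
qed

lemma immoralities_oriented_by:
  assumes "simple_graph V E" "inj_on f V"
    and "\<And>z. z \<in> V \<Longrightarrow> clique E {u \<in> V. {u, z} \<in> E \<and> f u < f z}"
  shows "immoralities (oriented_by E f) = {}"
proof (rule ccontr)
  assume "immoralities (oriented_by E f) \<noteq> {}"
  then obtain x z y where xzy: "{x, z} \<in> E" "f x < f z" "{y, z} \<in> E" "f y < f z" "x \<noteq> y" "{x, y} \<notin> E"
    unfolding immoralities_def skeleton_oriented_by[OF assms(1,2)]
    by (auto simp: oriented_by_def)
  moreover have "x \<in> V" "y \<in> V" "z \<in> V"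
    using xzy assms(1) by (fastforce simp: simple_graph_def)+
  ultimately show False
    using assms(3)[of z] by (auto simp: clique_def)
qed

text \<open>Simplicial vertices outside the clique \<open>{x, y}\<close> are peeled off one by one,
  each receiving a rank above all that remain. The ranks 0 and 1 for \<open>x\<close> and
  \<open>y\<close> are fixed so that exchanging them affects no comparison with a third
  vertex.\<close>

lemma elimination_rank:
  assumes "chordal E" "\<forall>e\<in>E. card e = 2" "{x, y} \<in> E" "finite W" "{x, y} \<subseteq> W"
  shows "\<exists>f :: 'a \<Rightarrow> nat. inj_on f W \<and> f x = 0 \<and> f y = 1 \<and>
    (\<forall>z\<in>W. clique E {u \<in> W. {u, z} \<in> E \<and> f u < f z})"
  using assms(4,5)
proof (induction W rule: finite_psubset_induct)
  case (psubset W)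
  have xy: "x \<noteq> y" using assms(2,3) by (rule edge_neq)
  show ?case
  proof (cases "W = {x, y}")
    case True
    then show ?thesis
      using xy by (intro exI[of _ "\<lambda>u. if u = x then 0 else 1"]) (auto simp: clique_def)
  next
    case False
    moreover have "clique E {x, y}" using assms(3) by (auto simp: clique_def insert_commute)
    ultimately obtain z where z: "simplicial E W z" "z \<notin> {x, y}"
      using simplicial_vertex_outside_clique[OF assms(1,2) psubset.hyps(1), of "{x, y}"] psubset.prems
      by blast
    then have zW: "z \<in> W" by (simp add: simplicial_def)
    obtain f :: "'a \<Rightarrow> nat" where f: "inj_on f (W - {z})" "f x = 0" "f y = 1"
        "\<And>v. v \<in> W - {z} \<Longrightarrow> clique E {u \<in> W - {z}. {u, v} \<in> E \<and> f u < f v}"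
      using psubset.IH[of "W - {z}"] zW z(2) psubset.prems by blast
    obtain m where m: "\<And>u. u \<in> W \<Longrightarrow> f u < m"
      using finite_nat_set_iff_bounded[of "f ` W"] psubset.hyps(1) by auto
    define g where "g = f(z := m)"
    have "inj_on g W"
    proof (rule inj_onI)
      fix u v assume "u \<in> W" "v \<in> W" "g u = g v"
      then show "u = v"
        using m[of u] m[of v] f(1) by (auto simp: g_def inj_on_def split: if_splits)
    qed
    moreover have "clique E {u \<in> W. {u, v} \<in> E \<and> g u < g v}" if "v \<in> W" for v
    proof (cases "v = z")
      case True
      then show ?thesis using z(1) by (auto simp: simplicial_def clique_def insert_commute)
    next
      case False
      then have "{u \<in> W. {u, v} \<in> E \<and> g u < g v} = {u \<in> W - {z}. {u, v} \<in> E \<and> f u < f v}"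
        using m[OF that] by (auto simp: g_def)
      then show ?thesis using f(4)[of v] False that by simp
    qed
    moreover have "g x = 0" "g y = 1" using f z(2) by (auto simp: g_def)
    ultimately show ?thesis by blast
  qed
qed

text \<open>If no experiment separates the edge \<open>xy\<close>, then reversing \<open>xy\<close> at the beginning of a
  perfect elimination order gives two graphs without immoralities that no experiment
  distinguishes.\<close>

theorem learns_every_imp_separates:
  assumes "simple_graph V E" "chordal E" "learns_every V E Is"
  shows "separates E Is"
  unfolding separates_def
proof (intro allI impI, rule ccontr)
  fix x y assume edge: "{x, y} \<in> E" and unsep: "\<not> (\<exists>I\<in>set Is. (x \<in> I) \<noteq> (y \<in> I))"
  have edges: "\<forall>e\<in>E. card e = 2" and "finite V" and xyV: "{x, y} \<subseteq> V"
    using assms(1) edge by (auto simp: simple_graph_def)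
  obtain f :: "'a \<Rightarrow> nat" where f: "inj_on f V" "f x = 0" "f y = 1"
      "\<And>z. z \<in> V \<Longrightarrow> clique E {u \<in> V. {u, z} \<in> E \<and> f u < f z}"
    using elimination_rank[OF assms(2) edges edge \<open>finite V\<close> xyV] by blast
  have xy: "x \<noteq> y" using edges edge by (rule edge_neq)
  define g where "g = f(x := 1, y := 0)"
  have big: "2 \<le> f u" if "u \<in> V" "u \<noteq> x" "u \<noteq> y" for u
  proof -
    have "f u \<noteq> f x" "f u \<noteq> f y" using that f(1) xyV by (auto dest: inj_onD)
    then show ?thesis using f by auto
  qed
  have gf: "g u < g v \<longleftrightarrow> f u < f v" if "u \<in> V" "v \<in> V" "{u, v} \<noteq> {x, y}" for u v
    using that big[of u] big[of v] f xy by (auto simp: g_def)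
  have "inj_on g V"
  proof (rule inj_onI)
    fix u v assume "u \<in> V" "v \<in> V" "g u = g v"
    then show "u = v"
      using big[of u] big[of v] f(1) xy by (auto simp: g_def inj_on_def split: if_splits)
  qed
  moreover have "clique E {u \<in> V. {u, z} \<in> E \<and> g u < g z}" if z: "z \<in> V" for z
  proof (cases "z = x \<or> z = y")
    case True
    \<comment> \<open>After the exchange \<open>y\<close> is the only vertex that can precede
      \<open>x\<close>, and nothing precedes \<open>y\<close>.\<close>
    then have "{u \<in> V. {u, z} \<in> E \<and> g u < g z} \<subseteq> {y}"
      using big xy by (fastforce simp: g_def split: if_splits)
    then show ?thesis unfolding clique_def by blast
  next
    case False
    then have "{u \<in> V. {u, z} \<in> E \<and> g u < g z} = {u \<in> V. {u, z} \<in> E \<and> f u < f z}"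
      using gf z by blast
    then show ?thesis using f(4)[OF z] by simp
  qed
  ultimately have g: "causal_graph V E (oriented_by E g)" "immoralities (oriented_by E g) = {}"
    using causal_graph_oriented_by immoralities_oriented_by assms(1) by blast+
  have f': "causal_graph V E (oriented_by E f)" "immoralities (oriented_by E f) = {}"
    using f causal_graph_oriented_by immoralities_oriented_by assms(1) by blast+
  have "(u, v) \<in> oriented_by E g \<longleftrightarrow> (u, v) \<in> oriented_by E f"
    if "{u, v} \<in> E" "\<exists>I\<in>set Is. (u \<in> I) \<noteq> (v \<in> I)" for u v
  proof -
    have "u \<in> V" "v \<in> V" using that(1) assms(1) by (auto simp: simple_graph_def)
    moreover have "{u, v} \<noteq> {x, y}" using that(2) unsep by (auto simp: doubleton_eq_iff)
    ultimately show ?thesis using gf by (simp add: oriented_by_def)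
  qed
  then have "oriented_by E g = oriented_by E f"
    using assms(3) f' g unfolding learns_every_def learns_def by metis
  moreover have "(x, y) \<in> oriented_by E f" "(x, y) \<notin> oriented_by E g"
    using f edge xy by (auto simp: oriented_by_def g_def)
  ultimately show False by blast
qed

lemma separates_imp_learns_every:
  assumes "separates E Is"
  shows "learns_every V E Is"
  unfolding learns_every_def learns_def
proof (intro allI impI)
  fix D D'
  assume D: "causal_graph V E D" and D': "causal_graph V E D' \<and> immoralities D' = immoralities D \<and>
    (\<forall>x y. {x, y} \<in> E \<and> (\<exists>I\<in>set Is. (x \<in> I) \<noteq> (y \<in> I)) \<longrightarrow> ((x, y) \<in> D' \<longleftrightarrow> (x, y) \<in> D))"
  have "{x, y} \<in> skeleton C" if "(x, y) \<in> C" for x y :: 'a and C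
    using that by (auto simp: skeleton_def)
  then have "{x, y} \<in> E" if "(x, y) \<in> D \<or> (x, y) \<in> D'" for x y
    using that D D' by (auto simp: causal_graph_def)
  then have "(x, y) \<in> D' \<longleftrightarrow> (x, y) \<in> D" for x y
    using D' assms unfolding separates_def by meson
  then show "D' = D" by auto
qed

section \<open>Designs and independent sets\<close>

definition independent_set :: "'a set set \<Rightarrow> 'a set \<Rightarrow> bool" where
  "independent_set E S \<longleftrightarrow> (\<forall>u\<in>S. \<forall>v\<in>S. {u, v} \<notin> E)"

lemma design_cost_singletons:
  "design_cost w (map set (map (\<lambda>v. [v]) vs)) = (\<Sum>v\<leftarrow>vs. w v)"
  by (simp add: design_cost_def o_def)

text \<open>Each vertex used is paid for at least once; overlaps only add nonnegative
  amounts.\<close>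

lemma sum_Union_le_design_cost:
  assumes "finite V" "\<forall>v\<in>V. 0 \<le> w v" "intervention_design V Is"
  shows "sum w (\<Union>(set Is)) \<le> design_cost w Is"
  using assms(3)
proof (induction Is)
  case (Cons I Is)
  have sub: "I \<subseteq> V" "\<Union>(set Is) \<subseteq> V" using Cons.prems by (auto simp: intervention_design_def)
  then have fin: "finite I" "finite (\<Union>(set Is))" using assms(1) finite_subset by blast+
  have "sum w (I \<union> \<Union>(set Is)) \<le> sum w I + sum w (\<Union>(set Is))"
    using sum.union_inter[OF fin, of w] sum_nonneg[of "I \<inter> \<Union>(set Is)" w] assms(2) sub
    by (smt (verit) IntE subsetD)
  then show ?case
    using Cons by (auto simp: design_cost_def intervention_design_def)
qed (simp add: design_cost_def)

theorem min_cost_design_singletons: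
  assumes "simple_graph V E" "chordal E" "\<forall>v\<in>V. 0 \<le> w v"
    and "S \<subseteq> V" "independent_set E S"
    and max: "\<And>T. T \<subseteq> V \<Longrightarrow> independent_set E T \<Longrightarrow> sum w T \<le> sum w S"
    and vs: "distinct vs" "set vs = V - S"
  shows "min_cost_design V E w (map set (map (\<lambda>v. [v]) vs))"
proof -
  let ?Is = "map set (map (\<lambda>v. [v]) vs)"
  have fin: "finite V" using assms(1) by (simp add: simple_graph_def)
  have edges: "\<forall>e\<in>E. card e = 2" using assms(1) by (simp add: simple_graph_def)
  have sep: "\<exists>I\<in>set ?Is. (x \<in> I) \<noteq> (y \<in> I)" if "{x, y} \<in> E" for x y
  proof -
    \<comment> \<open>An independent set misses an endpoint of each edge, and the singleton of that
      endpoint separates the edge.\<close>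
    have "x \<in> set vs \<or> y \<in> set vs"
      using that assms(1,5) vs by (auto simp: independent_set_def simple_graph_def)
    then show ?thesis
      using edge_neq[OF edges that] by auto
  qed
  have "intervention_design V ?Is" using vs by (auto simp: intervention_design_def)
  moreover have "learns_every V E ?Is"
    using sep by (intro separates_imp_learns_every) (auto simp: separates_def)
  moreover have "design_cost w ?Is \<le> design_cost w Js"
    if Js: "intervention_design V Js" "learns_every V E Js" for Js
  proof -
    let ?U = "\<Union>(set Js)"
    have U: "?U \<subseteq> V" using Js(1) by (auto simp: intervention_design_def)
    have "separates E Js"
      using learns_every_imp_separates assms(1,2) Js(2) by blast
    \<comment> \<open>Two adjacent vertices outside all experiments would be separated by none of
      them.\<close>
    then have "independent_set E (V - ?U)"
      by (auto simp: separates_def independent_set_def)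
    then have "sum w (V - ?U) \<le> sum w S" using max by blast
    moreover have "design_cost w ?Is = sum w (V - S)"
      using vs unfolding design_cost_singletons by (simp add: sum_list_distinct_conv_sum_set)
    ultimately show ?thesis
      using sum_Union_le_design_cost[OF fin assms(3) Js(1)]
        sum_diff[OF fin U, of w] sum_diff[OF fin assms(4), of w] by simp
  qed
  ultimately show ?thesis unfolding min_cost_design_def by blast
qed

lemma min_cost_design_imp_nonneg:
  assumes "min_cost_design V E w Is" "v \<in> V"
  shows "0 \<le> w v"
proof -
  \<comment> \<open>An additional experiment never destroys learning and changes the cost by exactly
    \<open>w v\<close>, so optimality forces \<open>0 \<le> w v\<close>.\<close>
  have "intervention_design V ({v} # Is)"
    using assms by (auto simp: min_cost_design_def intervention_design_def)
  moreover have "learns_every V E ({v} # Is)"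
    using assms(1) unfolding min_cost_design_def learns_every_def learns_def by (meson list.set_intros(2))
  ultimately have "design_cost w Is \<le> design_cost w ({v} # Is)"
    using assms(1) unfolding min_cost_design_def by blast
  then show ?thesis by (simp add: design_cost_def)
qed

section \<open>Maximum weight independent sets\<close>

text \<open>The positive residual weights \<open>max 0 (r (ord j))\<close> form a weighted cover of the vertices by
  the cliques \<open>K j\<close>. It bounds the weight of every independent set from above, and \<open>S\<close> attains
  the bound because it meets every clique of positive weight.\<close>

lemma frank_max_weight:
  fixes ord :: "nat \<Rightarrow> 'a" and r w :: "'a \<Rightarrow> real"
  assumes edges: "\<forall>e\<in>E. card e = 2"
    and inj: "inj_on ord {..<n}" and V: "ord ` {..<n} = V"
    and later: "\<And>k. k < n \<Longrightarrow> clique E {u \<in> V. {ord k, u} \<in> E \<and> u \<notin> ord ` {..k}}"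
    and r: "\<And>v. v \<in> V \<Longrightarrow> r v = w v -
      (\<Sum>j<n. if {ord j, v} \<in> E \<and> v \<notin> ord ` {..j} then max 0 (r (ord j)) else 0)"
    and S: "S \<subseteq> V" "\<And>k. k < n \<Longrightarrow> ord k \<in> S \<longleftrightarrow>
      0 < r (ord k) \<and> \<not> (\<exists>u\<in>S. {ord k, u} \<in> E \<and> u \<notin> ord ` {..k})"
  shows "independent_set E S"
    and "T \<subseteq> V \<Longrightarrow> independent_set E T \<Longrightarrow> sum w T \<le> sum w S"
proof -
  \<comment> \<open>\<open>K j\<close> is \<open>ord j\<close> with its neighbours still present
    after its elimination, a clique by \<open>later\<close>; \<open>y j\<close> is its dual
    weight.\<close>
  define K where "K j = {v \<in> V. v = ord j \<or> {ord j, v} \<in> E \<and> v \<notin> ord ` {..j}}" for j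
  define y where "y j = max 0 (r (ord j))" for j
  have fin: "finite V" using V by auto
  show indep: "independent_set E S"
    unfolding independent_set_def
  proof (intro ballI notI)
    fix u v assume uv: "u \<in> S" "v \<in> S" "{u, v} \<in> E"
    then obtain i j where ij: "i < n" "u = ord i" "j < n" "v = ord j" using S(1) V by blast
    have notin: "ord b \<notin> ord ` {..a}" if "a < b" "b < n" for a b
      using that inj by (auto dest!: inj_onD)
    have "i \<noteq> j" using uv ij edge_neq[OF edges] by auto
    then show False
      using S(2)[OF ij(1)] S(2)[OF ij(3)] uv ij notin[of i j] notin[of j i]
      by (metis insert_commute linorder_neqE_nat)
  qed
  \<comment> \<open>The cliques of earlier vertices contribute \<open>w v - r v\<close> by the
    residual equation, and the clique of \<open>v\<close> itself contributes
    \<open>max 0 (r v)\<close>. The total is at least \<open>w v\<close>, with equality when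
    \<open>0 < r v\<close>.\<close>
  have cover: "(\<Sum>j<n. if v \<in> K j then y j else 0) = w v - r v + max 0 (r v)" if v: "v \<in> V" for v
  proof -
    obtain k where k: "k < n" "v = ord k" using v V by blast
    have eq: "ord j = v \<longleftrightarrow> j = k" if "j < n" for j
      using that k inj by (auto dest: inj_onD)
    have "(\<Sum>j<n. if v \<in> K j then y j else 0) =
        (\<Sum>j<n. (if {ord j, v} \<in> E \<and> v \<notin> ord ` {..j} then max 0 (r (ord j)) else 0)
            + (if j = k then max 0 (r v) else 0))"
    proof (rule sum.cong)
      fix j assume "j \<in> {..<n}"
      then show "(if v \<in> K j then y j else 0) =
        (if {ord j, v} \<in> E \<and> v \<notin> ord ` {..j} then max 0 (r (ord j)) else 0)
            + (if j = k then max 0 (r v) else 0)"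
        using eq[of j] v k by (auto simp: K_def y_def)
    qed simp
    also have "\<dots> = w v - r v + max 0 (r v)"
      using r[OF v] k by (simp add: sum.distrib)
    finally show ?thesis .
  qed
  have swap: "(\<Sum>v\<in>A. \<Sum>j<n. if v \<in> K j then y j else 0) = (\<Sum>j<n. y j * card (A \<inter> K j))"
    if "A \<subseteq> V" for A
  proof -
    have "finite A" using that fin finite_subset by blast
    then show ?thesis
      by (subst sum.swap) (simp add: sum.If_cases mult.commute Int_def)
  qed
  have Kclique: "u = v" if "A \<subseteq> V" "independent_set E A" "j < n" "u \<in> A \<inter> K j" "v \<in> A \<inter> K j" for A j u v
  proof (rule ccontr)
    assume "u \<noteq> v"
    then have "{u, v} \<in> E"
      using that later[of j] by (auto simp: K_def clique_def insert_commute)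
    then show False using that by (auto simp: independent_set_def)
  qed
  have card1: "card (A \<inter> K j) \<le> 1" if "A \<subseteq> V" "independent_set E A" "j < n" for A j
    using Kclique[OF that] that(1) fin finite_subset
    by (metis card_le_Suc0_iff_eq finite_Int One_nat_def)
  assume T: "T \<subseteq> V" "independent_set E T"
  have "sum w T \<le> (\<Sum>v\<in>T. \<Sum>j<n. if v \<in> K j then y j else 0)"
    by (rule sum_mono) (use T cover in auto)
  also have "\<dots> = (\<Sum>j<n. y j * card (T \<inter> K j))"
    using swap[OF T(1)] .
  also have "\<dots> \<le> (\<Sum>j<n. y j * card (S \<inter> K j))"
  proof (rule sum_mono)
    fix j assume j: "j \<in> {..<n}"
    show "y j * card (T \<inter> K j) \<le> y j * card (S \<inter> K j)"
    proof (cases "0 < r (ord j)")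
      case True
      \<comment> \<open>By the greedy rule \<open>ord j\<close> is either selected or blocked by a
        selected later neighbour; both belong to \<open>K j\<close>.\<close>
      have "S \<inter> K j \<noteq> {}"
        using S(2)[of j] j True V S(1) by (auto simp: K_def)
      moreover have "finite (S \<inter> K j)" using S(1) fin finite_subset by blast
      ultimately have "1 \<le> card (S \<inter> K j)" by (simp add: Suc_leI card_gt_0_iff)
      with card1[OF T, of j] j have "card (T \<inter> K j) \<le> card (S \<inter> K j)" by simp
      then show ?thesis by (intro mult_left_mono) (auto simp: y_def)
    qed (simp add: y_def)
  qed
  also have "\<dots> = (\<Sum>v\<in>S. \<Sum>j<n. if v \<in> K j then y j else 0)"
    using swap[OF S(1)] by simp
  also have "\<dots> = sum w S"
  proof (rule sum.cong)
    fix v assume v: "v \<in> S"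
    then obtain k where "k < n" "v = ord k" using S(1) V by blast
    then have "0 < r v" using v S(2) by blast
    then show "(\<Sum>j<n. if v \<in> K j then y j else 0) = w v"
      using cover v S(1) by auto
  qed simp
  finally show "sum w T \<le> sum w S" .
qed

section \<open>Running programs in polynomial time\<close>

text \<open>All loops of the program below make at most \<open>n\<close> iterations.\<close>

fun time_poly :: "com \<Rightarrow> nat poly" where
  "time_poly Skip = 1"
| "time_poly (NAssign a i e) = 1"
| "time_poly (RAssign a i e) = 1"
| "time_poly (Output e) = 1"
| "time_poly (Seq c1 c2) = time_poly c1 + time_poly c2"
| "time_poly (If b c1 c2) = 1 + time_poly c1 + time_poly c2"
| "time_poly (While b c) = 1 + [:0, 1:] * (1 + time_poly c)"

text \<open>A weakest precondition for total correctness with the time bound built in: since the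
  bound depends only on \<open>c\<close> and \<open>n\<close>, the rules below compose
  postconditions alone.\<close>

definition run :: "nat \<Rightarrow> com \<Rightarrow> ram_state \<Rightarrow> (ram_state \<Rightarrow> bool) \<Rightarrow> bool" where
  "run n c s Q \<longleftrightarrow> (\<exists>t s'. exec c s t s' \<and> t \<le> poly (time_poly c) n \<and> Q s')"

abbreviation set_nat :: "nat \<Rightarrow> nat \<Rightarrow> nat \<Rightarrow> ram_state \<Rightarrow> ram_state" where
  "set_nat a i v s \<equiv> s\<lparr>nmem := (nmem s)(a := (nmem s a)(i := v))\<rparr>"

abbreviation set_real :: "nat \<Rightarrow> nat \<Rightarrow> real \<Rightarrow> ram_state \<Rightarrow> ram_state" where
  "set_real a i v s \<equiv> s\<lparr>rmem := (rmem s)(a := (rmem s a)(i := v))\<rparr>"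

lemma run_mono: "run n c s Q \<Longrightarrow> (\<And>s'. Q s' \<Longrightarrow> R s') \<Longrightarrow> run n c s R"
  unfolding run_def by blast

lemma run_Skip: "Q s \<Longrightarrow> run n Skip s Q"
  unfolding run_def by (force intro: exec.Skip)

lemma run_NAssign: "Q (set_nat a (nval i s) (nval e s) s) \<Longrightarrow> run n (NAssign a i e) s Q"
  unfolding run_def by (force intro: exec.NAssign)

lemma run_RAssign: "Q (set_real a (nval i s) (rval e s) s) \<Longrightarrow> run n (RAssign a i e) s Q"
  unfolding run_def by (force intro: exec.RAssign)

lemma run_Output: "Q (s\<lparr>outp := outp s @ [nval e s]\<rparr>) \<Longrightarrow> run n (Output e) s Q"
  unfolding run_def by (force intro: exec.Output)

lemma run_Seq: "run n c1 s (\<lambda>s'. run n c2 s' Q) \<Longrightarrow> run n (Seq c1 c2) s Q"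
  unfolding run_def by (fastforce intro: exec.Seq add_mono)

lemma run_If:
  assumes "bval b s \<Longrightarrow> run n c1 s Q" "\<not> bval b s \<Longrightarrow> run n c2 s Q"
  shows "run n (If b c1 c2) s Q"
proof (cases "bval b s")
  case True
  then obtain t s' where "exec c1 s t s'" "t \<le> poly (time_poly c1) n" "Q s'"
    using assms(1) unfolding run_def by blast
  then show ?thesis
    using True unfolding run_def by (intro exI[of _ "Suc t"] exI[of _ s']) (auto intro: exec.IfTrue)
next
  case False
  then obtain t s' where "exec c2 s t s'" "t \<le> poly (time_poly c2) n" "Q s'"
    using assms(2) unfolding run_def by blast
  then show ?thesis
    using False unfolding run_def by (intro exI[of _ "Suc t"] exI[of _ s']) (auto intro: exec.IfFalse)
qed

abbreviation var :: "nat \<Rightarrow> nexp" where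
  "var x \<equiv> NCell x (NConst 0)"

definition for_loop :: "nat \<Rightarrow> com \<Rightarrow> com" where
  "for_loop x body = Seq (NAssign x (NConst 0) (NConst 0))
     (While (NLess (var x) (var 0)) (Seq body (NAssign x (NConst 0) (NAdd (var x) (NConst 1)))))"

text \<open>The invariant is stated for the state after the counter has been advanced, so the body
  must leave both the counter and the size cell as it found them.\<close>

lemma run_for_loop:
  assumes n: "nmem s 0 0 = n" and x: "x \<noteq> 0"
    and init: "I 0 (set_nat x 0 0 s)"
    and step: "\<And>i s. I i s \<Longrightarrow> nmem s x 0 = i \<Longrightarrow> nmem s 0 0 = n \<Longrightarrow> i < n \<Longrightarrow>
      run n body s (\<lambda>s'. nmem s' x 0 = i \<and> nmem s' 0 0 = n \<and> I (Suc i) (set_nat x 0 (Suc i) s'))"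
    and final: "\<And>s. I n s \<Longrightarrow> nmem s x 0 = n \<Longrightarrow> nmem s 0 0 = n \<Longrightarrow> Q s"
  shows "run n (for_loop x body) s Q"
proof -
  let ?c = "Seq body (NAssign x (NConst 0) (NAdd (var x) (NConst 1)))"
  let ?w = "While (NLess (var x) (var 0)) ?c"
  let ?C = "poly (time_poly ?c) n"
  \<comment> \<open>Here \<open>m\<close> is the number of iterations left; each costs one test and
    one body, and the leading 1 is the final failing test.\<close>
  have "\<exists>t s'. exec ?w s t s' \<and> t \<le> 1 + m * (1 + ?C) \<and> Q s'"
    if "I (n - m) s" "nmem s x 0 = n - m" "nmem s 0 0 = n" "m \<le> n" for m s
    using that
  proof (induction m arbitrary: s)
    case 0
    then have "exec ?w s 1 s" by (intro exec.WhileFalse) simp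
    moreover have "Q s" using 0 final by simp
    ultimately show ?case by fastforce
  next
    case (Suc m)
    let ?i = "n - Suc m"
    have i: "Suc ?i = n - m" using Suc.prems by simp
    have "run n body s (\<lambda>s'. nmem s' x 0 = ?i \<and> nmem s' 0 0 = n \<and> I (Suc ?i) (set_nat x 0 (Suc ?i) s'))"
      using Suc.prems by (intro step) auto
    then have "run n ?c s (\<lambda>s'. nmem s' x 0 = n - m \<and> nmem s' 0 0 = n \<and> I (n - m) s')"
      by (intro run_Seq, elim run_mono) (use x i in \<open>auto intro!: run_NAssign\<close>)
    then obtain t1 s1 where s1: "exec ?c s t1 s1" "t1 \<le> ?C"
        "nmem s1 x 0 = n - m" "nmem s1 0 0 = n" "I (n - m) s1"
      unfolding run_def by blast
    then obtain t2 s2 where s2: "exec ?w s1 t2 s2" "t2 \<le> 1 + m * (1 + ?C)" "Q s2"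
      using Suc.IH[of s1] Suc.prems by auto
    have "bval (NLess (var x) (var 0)) s" using Suc.prems by simp
    from exec.WhileTrue[OF this s1(1) s2(1)] show ?case
      using s1(2) s2 by (intro exI[of _ "Suc (t1 + t2)"] exI[of _ s2]) auto
  qed
  from this[of n "set_nat x 0 0 s"] obtain t s'
    where "exec ?w (set_nat x 0 0 s) t s'" "t \<le> 1 + n * (1 + ?C)" "Q s'"
    using init n x by auto
  then show ?thesis
    unfolding run_def for_loop_def
    using exec.Seq[OF exec.NAssign[of x "NConst 0" "NConst 0" s], of ?w t s']
    by (intro exI[of _ "1 + t"] exI[of _ s']) auto
qed


text \<open>\<open>X\<close> lists the natural arrays that may have changed; the real memory and the
  output are fixed throughout.\<close>

definition frame :: "nat set \<Rightarrow> ram_state \<Rightarrow> ram_state \<Rightarrow> bool" where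
  "frame X s s' \<longleftrightarrow> rmem s' = rmem s \<and> outp s' = outp s \<and> (\<forall>a. a \<notin> X \<longrightarrow> nmem s' a = nmem s a)"

lemma frame_refl [simp]: "frame X s s"
  by (simp add: frame_def)

lemma frame_fun_upd [simp]:
  "a \<in> X \<Longrightarrow> frame X s (s'\<lparr>nmem := m(a := f)\<rparr>) \<longleftrightarrow> frame X s (s'\<lparr>nmem := m\<rparr>)"
  by (auto simp: frame_def)

lemma frame_nmem_same [simp]: "frame X s (s'\<lparr>nmem := nmem s'\<rparr>) \<longleftrightarrow> frame X s s'"
  by (simp add: frame_def)

lemma frame_trans: "frame X s s' \<Longrightarrow> frame Y s' s'' \<Longrightarrow> Y \<subseteq> X \<Longrightarrow> frame X s s''"
  by (auto simp: frame_def subset_iff)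

lemma frame_nmem: "frame X s s' \<Longrightarrow> a \<notin> X \<Longrightarrow> nmem s' a = nmem s a"
  by (simp add: frame_def)

text \<open>A bounded universal quantifier. The flag in array 10 can only be cleared, so its old
  value enters as a conjunct, which allows such loops to be nested. The guard is evaluated only in
  states that differ from \<open>s\<close> in the counter and the flag.\<close>

lemma run_flag_loop:
  assumes "nmem s 0 0 = n" "x \<noteq> 0" "x \<noteq> 10"
    and b: "\<And>s' i. i < n \<Longrightarrow> frame {x, 10} s s' \<Longrightarrow> nmem s' x 0 = i \<Longrightarrow> bval b s' \<longleftrightarrow> P i"
  shows "run n (for_loop x (If b (NAssign 10 (NConst 0) (NConst 0)) Skip)) s
    (\<lambda>s'. frame {x, 10} s s' \<and> (0 < nmem s' 10 0 \<longleftrightarrow> 0 < nmem s 10 0 \<and> (\<forall>i<n. \<not> P i)))"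
  by (rule run_for_loop[where I = "\<lambda>i s'. frame {x, 10} s s' \<and>
        (0 < nmem s' 10 0 \<longleftrightarrow> 0 < nmem s 10 0 \<and> (\<forall>j<i. \<not> P j))"])
    (use assms in \<open>auto intro!: run_If run_NAssign run_Skip simp: less_Suc_eq\<close>)

section \<open>The program\<close>

text \<open>Besides the input, the natural arrays hold: 2 the offsets of the rows of the adjacency matrix,
  3 the eliminated vertices, 4 the elimination order, 5 the independent set, and 6 to 11 scalars.
  The real array 0 holds the residual weights.\<close>

definition is_set :: "nexp \<Rightarrow> bexp" where
  "is_set e = NLess (NConst 0) e"

definition adjacent :: "nexp \<Rightarrow> nexp \<Rightarrow> bexp" where
  "adjacent u v = is_set (NCell 1 (NAdd (NCell 2 u) v))"

lemma bval_is_set [simp]: "bval (is_set e) s \<longleftrightarrow> 0 < nval e s"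
  by (simp add: is_set_def)

definition loaded :: "nat \<Rightarrow> nat set set \<Rightarrow> ram_state \<Rightarrow> bool" where
  "loaded n E s \<longleftrightarrow> nmem s 0 0 = n \<and> (\<forall>u<n. nmem s 2 u = u * n) \<and>
     (\<forall>u<n. \<forall>v<n. 0 < nmem s 1 (u * n + v) \<longleftrightarrow> {u, v} \<in> E)"

lemma loaded_fun_upd [simp]:
  "2 < a \<Longrightarrow> loaded n E (s\<lparr>nmem := m(a := f)\<rparr>) \<longleftrightarrow> loaded n E (s\<lparr>nmem := m\<rparr>)"
  by (simp add: loaded_def)

lemma loaded_nmem_same [simp]: "loaded n E (s\<lparr>nmem := nmem s\<rparr>) \<longleftrightarrow> loaded n E s"
  by (simp add: loaded_def)

lemma loaded_frame: "loaded n E s \<Longrightarrow> frame X s s' \<Longrightarrow> {0, 1, 2} \<inter> X = {} \<Longrightarrow> loaded n E s'"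
  by (simp add: loaded_def frame_nmem)

lemma loaded_size: "loaded n E s \<Longrightarrow> nmem s 0 0 = n"
  by (simp add: loaded_def)

lemma bval_adjacent:
  "loaded n E s \<Longrightarrow> nval u s < n \<Longrightarrow> nval v s < n \<Longrightarrow>
    bval (adjacent u v) s \<longleftrightarrow> {nval u s, nval v s} \<in> E"
  by (simp add: loaded_def adjacent_def)

subsection \<open>Checking the costs and preparing the input\<close>

definition check_costs :: com where
  "check_costs = Seq (NAssign 10 (NConst 0) (NConst 1))
     (for_loop 7 (If (RLess (RCell 0 (var 7)) RZero) (NAssign 10 (NConst 0) (NConst 0)) Skip))"

lemma run_check_costs:
  assumes "nmem s 0 0 = n"
  shows "run n check_costs s (\<lambda>s'. frame {7, 10} s s' \<and>
    (0 < nmem s' 10 0 \<longleftrightarrow> (\<forall>v<n. 0 \<le> rmem s 0 v)))"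
  unfolding check_costs_def
  by (intro run_Seq run_NAssign run_mono[OF run_flag_loop[where P = "\<lambda>v. rmem s 0 v < 0"]])
    (use assms in \<open>auto simp: frame_def not_less\<close>)

text \<open>Replaces the multiplication \<open>u * n\<close> in matrix addresses by a running
  sum.\<close>

definition row_offsets :: com where
  "row_offsets = for_loop 7 (NAssign 2 (NAdd (var 7) (NConst 1)) (NAdd (NCell 2 (var 7)) (var 0)))"

lemma run_row_offsets:
  assumes "nmem s 0 0 = n" "nmem s 2 0 = 0"
  shows "run n row_offsets s (\<lambda>s'. frame {2, 7} s s' \<and> (\<forall>u<n. nmem s' 2 u = u * n))"
  unfolding row_offsets_def
  by (rule run_for_loop[where I = "\<lambda>i s'. frame {2, 7} s s' \<and> (\<forall>u\<le>i. nmem s' 2 u = u * n)"])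
    (use assms in \<open>auto intro!: run_NAssign simp: le_Suc_eq\<close>)

subsection \<open>Eliminating simplicial vertices\<close>

abbreviation remaining :: "nat \<Rightarrow> (nat \<Rightarrow> nat) \<Rightarrow> nat set" where
  "remaining n dead \<equiv> {u. u < n \<and> dead u = 0}"

text \<open>Truncated subtraction makes the flag start positive exactly when the candidate is not
  yet eliminated. By symmetry it is enough to test increasing pairs, which also excludes equal
  vertices.\<close>

definition check_simplicial :: com where
  "check_simplicial = Seq (NAssign 10 (NConst 0) (NSub (NConst 1) (NCell 3 (var 7))))
     (for_loop 8 (for_loop 9
       (If (BAnd (BAnd (BAnd (BNot (is_set (NCell 3 (var 8)))) (BNot (is_set (NCell 3 (var 9)))))
                       (BAnd (adjacent (var 7) (var 8)) (adjacent (var 7) (var 9))))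
                 (BAnd (NLess (var 8) (var 9)) (BNot (adjacent (var 8) (var 9)))))
         (NAssign 10 (NConst 0) (NConst 0)) Skip)))"

lemma run_check_simplicial:
  assumes s: "loaded n E s" and v: "nmem s 7 0 = v" "v < n"
  shows "run n check_simplicial s (\<lambda>s'. frame {8, 9, 10} s s' \<and>
    (0 < nmem s' 10 0 \<longleftrightarrow> simplicial E (remaining n (nmem s 3)) v))"
proof -
  define P where "P a b \<longleftrightarrow> nmem s 3 a = 0 \<and> nmem s 3 b = 0 \<and> {v, a} \<in> E \<and> {v, b} \<in> E \<and>
    a < b \<and> {a, b} \<notin> E" for a b
  have simp_iff: "simplicial E (remaining n (nmem s 3)) v \<longleftrightarrow>
      nmem s 3 v = 0 \<and> (\<forall>a<n. \<forall>b<n. \<not> P a b)"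
  proof -
    have "clique E {u \<in> remaining n (nmem s 3). {v, u} \<in> E} \<longleftrightarrow> (\<forall>a<n. \<forall>b<n. \<not> P a b)"
    proof
      assume "clique E {u \<in> remaining n (nmem s 3). {v, u} \<in> E}"
      then show "\<forall>a<n. \<forall>b<n. \<not> P a b"
        by (auto simp: clique_def P_def)
    next
      assume "\<forall>a<n. \<forall>b<n. \<not> P a b"
      then have noP: "\<not> P a b" if "a < n" "b < n" for a b
        using that by simp
      have less: "{a, b} \<in> E" if "a < b" "a \<in> remaining n (nmem s 3)" "b \<in> remaining n (nmem s 3)"
          "{v, a} \<in> E" "{v, b} \<in> E" for a b
        using noP[of a b] that by (simp add: P_def)
      show "clique E {u \<in> remaining n (nmem s 3). {v, u} \<in> E}"
        unfolding clique_def
      proof (intro ballI impI)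
        fix a b assume ab: "a \<in> {u \<in> remaining n (nmem s 3). {v, u} \<in> E}"
            "b \<in> {u \<in> remaining n (nmem s 3). {v, u} \<in> E}" "a \<noteq> b"
        show "{a, b} \<in> E"
          by (rule linorder_cases[of a b]) (use ab less[of a b] less[of b a] in \<open>simp_all add: insert_commute\<close>)
      qed
    qed
    then show ?thesis using v by (simp add: simplicial_def)
  qed
  let ?I = "\<lambda>i s'. frame {8, 9, 10} s s' \<and>
    (0 < nmem s' 10 0 \<longleftrightarrow> nmem s 3 v = 0 \<and> (\<forall>a<i. \<forall>b<n. \<not> P a b))"
  show ?thesis
    unfolding check_simplicial_def simp_iff
  proof (rule run_Seq, rule run_NAssign, rule run_for_loop[where I = ?I])
    fix i s1 assume I: "?I i s1" and i: "nmem s1 8 0 = i" "i < n" "nmem s1 0 0 = n"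
    show "run n (for_loop 9
       (If (BAnd (BAnd (BAnd (BNot (is_set (NCell 3 (var 8)))) (BNot (is_set (NCell 3 (var 9)))))
                       (BAnd (adjacent (var 7) (var 8)) (adjacent (var 7) (var 9))))
                 (BAnd (NLess (var 8) (var 9)) (BNot (adjacent (var 8) (var 9)))))
         (NAssign 10 (NConst 0) (NConst 0)) Skip)) s1
       (\<lambda>s'. nmem s' 8 0 = i \<and> nmem s' 0 0 = n \<and> ?I (Suc i) (set_nat 8 0 (Suc i) s'))"
    proof (rule run_mono[OF run_flag_loop[where P = "P i"]])
      fix s2 j assume j: "j < n" "frame {9, 10} s1 s2" "nmem s2 9 0 = j"
      have "frame {8, 9, 10} s s2"
        by (rule frame_trans[of _ s s1 "{9, 10}"]) (use I j in auto)
      then have "loaded n E s2" "nmem s2 3 = nmem s 3" "nmem s2 7 = nmem s 7" "nmem s2 8 0 = i"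
        using loaded_frame[OF s, of "{8, 9, 10}" s2] i j by (simp_all add: frame_def)
      then show "bval (BAnd (BAnd (BAnd (BNot (is_set (NCell 3 (var 8)))) (BNot (is_set (NCell 3 (var 9)))))
                       (BAnd (adjacent (var 7) (var 8)) (adjacent (var 7) (var 9))))
                 (BAnd (NLess (var 8) (var 9)) (BNot (adjacent (var 8) (var 9))))) s2 \<longleftrightarrow> P i j"
        using i j v by (auto simp: bval_adjacent P_def)
    next
      fix s2 assume s2: "frame {9, 10} s1 s2 \<and>
        (0 < nmem s2 10 0 \<longleftrightarrow> 0 < nmem s1 10 0 \<and> (\<forall>b<n. \<not> P i b))"
      have "frame {8, 9, 10} s s2"
        by (rule frame_trans[of _ s s1 "{9, 10}"]) (use I s2 in auto)
      then show "nmem s2 8 0 = i \<and> nmem s2 0 0 = n \<and> ?I (Suc i) (set_nat 8 0 (Suc i) s2)"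
        using s2 I i by (auto simp: less_Suc_eq frame_nmem)
    qed (use i in auto)
  qed (use s v in \<open>auto simp: loaded_size frame_def\<close>)
qed

definition find_simplicial :: com where
  "find_simplicial = for_loop 7 (Seq check_simplicial
     (If (is_set (var 10)) (NAssign 11 (NConst 0) (var 7)) Skip))"

lemma run_find_simplicial:
  assumes s: "loaded n E s" and ex: "simplicial E (remaining n (nmem s 3)) v"
  shows "run n find_simplicial s (\<lambda>s'. frame {7, 8, 9, 10, 11} s s' \<and>
    simplicial E (remaining n (nmem s 3)) (nmem s' 11 0))"
proof -
  let ?P = "simplicial E (remaining n (nmem s 3))"
  \<comment> \<open>Later finds overwrite earlier ones, and nothing is claimed about array 11 until
    a first simplicial vertex has been met.\<close>
  let ?I = "\<lambda>i s'. frame {7, 8, 9, 10, 11} s s' \<and> ((\<exists>v<i. ?P v) \<longrightarrow> ?P (nmem s' 11 0))"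
  show ?thesis
    unfolding find_simplicial_def
  proof (rule run_for_loop[where I = ?I])
    fix i s1 assume I: "?I i s1" and i: "nmem s1 7 0 = i" "i < n" "nmem s1 0 0 = n"
    have s1: "loaded n E s1" "nmem s1 3 = nmem s 3"
      using conjunct1[OF I] loaded_frame[OF s, of "{7, 8, 9, 10, 11}" s1] by (simp_all add: frame_nmem)
    show "run n (Seq check_simplicial (If (is_set (var 10)) (NAssign 11 (NConst 0) (var 7)) Skip)) s1
       (\<lambda>s'. nmem s' 7 0 = i \<and> nmem s' 0 0 = n \<and> ?I (Suc i) (set_nat 7 0 (Suc i) s'))"
    proof (rule run_Seq, rule run_mono[OF run_check_simplicial[OF s1(1) i(1,2)]])
      fix s2 assume s2: "frame {8, 9, 10} s1 s2 \<and>
        (0 < nmem s2 10 0 \<longleftrightarrow> simplicial E (remaining n (nmem s1 3)) i)"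
      have "frame {7, 8, 9, 10, 11} s s2"
        by (rule frame_trans[of _ s s1 "{8, 9, 10}"]) (use I s2 in auto)
      moreover have "nmem s2 7 0 = i" "nmem s2 0 0 = n" "nmem s2 11 = nmem s1 11"
        using s2 i by (auto simp: frame_nmem)
      ultimately show "run n (If (is_set (var 10)) (NAssign 11 (NConst 0) (var 7)) Skip) s2
        (\<lambda>s'. nmem s' 7 0 = i \<and> nmem s' 0 0 = n \<and> ?I (Suc i) (set_nat 7 0 (Suc i) s'))"
        using I s2 s1 by (intro run_If run_NAssign run_Skip) (simp_all add: less_Suc_eq, auto)
    qed
  next
    fix s' assume "?I n s'"
    moreover have "v < n" using ex by (simp add: simplicial_def)
    ultimately show "frame {7, 8, 9, 10, 11} s s' \<and> ?P (nmem s' 11 0)" using ex by blast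
  qed (use s in \<open>simp_all add: loaded_size frame_def\<close>)
qed

definition reduce_weights :: com where
  "reduce_weights = If (RLess RZero (RCell 0 (var 11)))
     (for_loop 7 (If (BAnd (BNot (is_set (NCell 3 (var 7)))) (adjacent (var 11) (var 7)))
        (RAssign 0 (var 7) (RSub (RCell 0 (var 7)) (RCell 0 (var 11)))) Skip)) Skip"

text \<open>The bound \<open>n\<close> doubles as a loop counter: with \<open>i\<close> in its place
  the function describes the residuals after \<open>i\<close> iterations.\<close>

definition reduced :: "nat \<Rightarrow> nat set set \<Rightarrow> (nat \<Rightarrow> nat) \<Rightarrow> nat \<Rightarrow> (nat \<Rightarrow> real) \<Rightarrow> nat \<Rightarrow> real" where
  "reduced n E dead f r v = (if v < n \<and> dead v = 0 \<and> {f, v} \<in> E then r v - max 0 (r f) else r v)"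

lemma run_reduce_weights:
  assumes s: "loaded n E s" and f: "nmem s 11 0 = f" "f < n" "0 < nmem s 3 f"
  shows "run n reduce_weights s (\<lambda>s'. (\<forall>a. a \<noteq> 7 \<longrightarrow> nmem s' a = nmem s a) \<and> outp s' = outp s \<and>
    rmem s' 0 = reduced n E (nmem s 3) f (rmem s 0))"
proof -
  let ?I = "\<lambda>i (s' :: ram_state). (\<forall>a. a \<noteq> 7 \<longrightarrow> nmem s' a = nmem s a) \<and> outp s' = outp s \<and>
    rmem s' 0 = reduced i E (nmem s 3) f (rmem s 0)"
  have loaded: "loaded n E s'" if "\<forall>a. a \<noteq> 7 \<longrightarrow> nmem s' a = nmem s a" for s'
    using s that by (simp add: loaded_def)
  show ?thesis
    unfolding reduce_weights_def
  proof (rule run_If)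
    assume pos: "bval (RLess RZero (RCell 0 (var 11))) s"
    show "run n (for_loop 7 (If (BAnd (BNot (is_set (NCell 3 (var 7)))) (adjacent (var 11) (var 7)))
        (RAssign 0 (var 7) (RSub (RCell 0 (var 7)) (RCell 0 (var 11)))) Skip)) s (?I n)"
    proof (rule run_for_loop[where I = ?I])
      fix i s1 assume I: "?I i s1" and i: "nmem s1 7 0 = i" "i < n" "nmem s1 0 0 = n"
      have "bval (adjacent (var 11) (var 7)) s1 \<longleftrightarrow> {f, i} \<in> E"
        using loaded I i f by (simp add: bval_adjacent[of n E])
      \<comment> \<open>\<open>f\<close> is already marked as eliminated, so its residual stays
        fixed while it is being subtracted from the others; entry \<open>i\<close> has not been
        reached yet.\<close>
      moreover have "rmem s1 0 f = rmem s 0 f" "rmem s1 0 i = rmem s 0 i"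
        using I f by (auto simp: reduced_def)
      ultimately show "run n (If (BAnd (BNot (is_set (NCell 3 (var 7)))) (adjacent (var 11) (var 7)))
        (RAssign 0 (var 7) (RSub (RCell 0 (var 7)) (RCell 0 (var 11)))) Skip) s1
        (\<lambda>s'. nmem s' 7 0 = i \<and> nmem s' 0 0 = n \<and> ?I (Suc i) (set_nat 7 0 (Suc i) s'))"
        using I i f pos
        by (intro run_If run_RAssign run_Skip) (auto simp: reduced_def fun_eq_iff less_Suc_eq)
    qed (use s f in \<open>auto simp: loaded_def reduced_def fun_eq_iff\<close>)
  next
    assume "\<not> bval (RLess RZero (RCell 0 (var 11))) s"
    then show "run n Skip s (?I n)"
      using f by (intro run_Skip) (auto simp: reduced_def fun_eq_iff)
  qed
qed

text \<open>The residual equation uses the current value of \<open>r (ord j)\<close> instead of the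
  one at the time of elimination. The two agree because eliminated vertices are never updated again,
  and at \<open>i = n\<close> the equation becomes the one required by
  \<open>frank_max_weight\<close>.\<close>

definition elimination ::
  "nat \<Rightarrow> nat set set \<Rightarrow> (nat \<Rightarrow> real) \<Rightarrow> nat \<Rightarrow> (nat \<Rightarrow> nat) \<Rightarrow> (nat \<Rightarrow> nat) \<Rightarrow> (nat \<Rightarrow> real) \<Rightarrow> bool" where
  "elimination n E w i dead ord r \<longleftrightarrow>
     inj_on ord {..<i} \<and> ord ` {..<i} \<subseteq> {..<n} \<and> (\<forall>v<n. dead v = 0 \<longleftrightarrow> v \<notin> ord ` {..<i}) \<and>
     (\<forall>k<i. clique E {u \<in> {..<n}. {ord k, u} \<in> E \<and> u \<notin> ord ` {..k}}) \<and>
     (\<forall>v<n. r v = w v -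
        (\<Sum>j<i. if {ord j, v} \<in> E \<and> v \<notin> ord ` {..j} then max 0 (r (ord j)) else 0))"

lemma elimination_step:
  assumes "elimination n E w i dead ord r" "simplicial E (remaining n dead) f"
  shows "elimination n E w (Suc i) (dead(f := 1)) (ord(i := f)) (reduced n E (dead(f := 1)) f r)"
proof -
  let ?dead = "dead(f := 1)" and ?ord = "ord(i := f)"
  let ?r = "reduced n E ?dead f r"
  have inj: "inj_on ord {..<i}" and ran: "ord ` {..<i} \<subseteq> {..<n}"
    and dead: "\<And>v. v < n \<Longrightarrow> dead v = 0 \<longleftrightarrow> v \<notin> ord ` {..<i}"
    and later: "\<And>k. k < i \<Longrightarrow> clique E {u \<in> {..<n}. {ord k, u} \<in> E \<and> u \<notin> ord ` {..k}}"
    and r: "\<And>v. v < n \<Longrightarrow> r v = w v -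
        (\<Sum>j<i. if {ord j, v} \<in> E \<and> v \<notin> ord ` {..j} then max 0 (r (ord j)) else 0)"
    using assms(1) by (auto simp: elimination_def)
  have f: "f < n" "f \<notin> ord ` {..<i}" and f_clique: "clique E {u \<in> remaining n dead. {f, u} \<in> E}"
    using assms(2) dead by (auto simp: simplicial_def)
  have img: "?ord ` {..k} = ord ` {..k}" if "k < i" for k
    using that by auto
  have img_i: "?ord ` {..i} = insert f (ord ` {..<i})"
    by (auto simp: image_iff less_le)
  have img_Suc: "?ord ` {..<Suc i} = insert f (ord ` {..<i})"
    using img_i by (simp add: lessThan_Suc_atMost)
  have r_old: "?r (ord j) = r (ord j)" if "j < i" for j
    using that dead[of "ord j"] by (auto simp: reduced_def)
  have r_f: "?r f = r f" by (simp add: reduced_def)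
  have "inj_on ?ord {..<Suc i}"
    using inj f(2) by (auto simp: inj_on_def less_Suc_eq)
  moreover have "?ord ` {..<Suc i} \<subseteq> {..<n}"
    using img_Suc ran f by auto
  moreover have "?dead v = 0 \<longleftrightarrow> v \<notin> ?ord ` {..<Suc i}" if "v < n" for v
    using dead[OF that] img_Suc by auto
  moreover have "clique E {u \<in> {..<n}. {?ord k, u} \<in> E \<and> u \<notin> ?ord ` {..k}}" if "k < Suc i" for k
  proof (cases "k = i")
    case True
    have "{u \<in> {..<n}. {?ord k, u} \<in> E \<and> u \<notin> ?ord ` {..k}} \<subseteq> {u \<in> remaining n dead. {f, u} \<in> E}"
      unfolding True img_i using dead by auto
    then show ?thesis using f_clique unfolding clique_def by blast
  next
    case False
    then show ?thesis using that later[of k] img[of k] by simp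
  qed
  moreover have "?r v = w v - (\<Sum>j<Suc i. if {?ord j, v} \<in> E \<and> v \<notin> ?ord ` {..j}
      then max 0 (?r (?ord j)) else 0)" if v: "v < n" for v
  proof -
    \<comment> \<open>The summands below \<open>i\<close> keep their values because those residuals
      are frozen; summand \<open>i\<close> is exactly what the update subtracts from
      \<open>v\<close>.\<close>
    define g where "g j = (if {?ord j, v} \<in> E \<and> v \<notin> ?ord ` {..j} then max 0 (?r (?ord j)) else 0)" for j
    have "sum g {..<i} =
        (\<Sum>j<i. if {ord j, v} \<in> E \<and> v \<notin> ord ` {..j} then max 0 (r (ord j)) else 0)"
      by (rule sum.cong) (use img r_old in \<open>auto simp: g_def\<close>)
    moreover have "?r v = r v - g i"
      unfolding g_def img_i fun_upd_same r_f using v dead[OF v] by (auto simp: reduced_def)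
    ultimately have "?r v = w v - sum g {..<Suc i}" using r[OF v] by simp
    then show ?thesis unfolding g_def .
  qed
  ultimately show ?thesis unfolding elimination_def by blast
qed

definition eliminate :: com where
  "eliminate = for_loop 6 (Seq find_simplicial (Seq (NAssign 4 (var 6) (var 11))
     (Seq (NAssign 3 (var 11) (NConst 1)) reduce_weights)))"

lemma run_eliminate:
  assumes s: "loaded n E s" and dead: "nmem s 3 = (\<lambda>_. 0)"
    and chordal: "chordal E" "\<forall>e\<in>E. card e = 2"
  shows "run n eliminate s (\<lambda>s'. loaded n E s' \<and> nmem s' 5 = nmem s 5 \<and> outp s' = outp s \<and>
    elimination n E (rmem s 0) n (nmem s' 3) (nmem s' 4) (rmem s' 0))"
proof -
  let ?I = "\<lambda>i s'. loaded n E s' \<and> nmem s' 5 = nmem s 5 \<and> outp s' = outp s \<and>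
    elimination n E (rmem s 0) i (nmem s' 3) (nmem s' 4) (rmem s' 0)"
  show ?thesis
    unfolding eliminate_def
  proof (rule run_for_loop[where I = ?I])
    fix i s1 assume I: "?I i s1" and i: "nmem s1 6 0 = i" "i < n"
    have el: "elimination n E (rmem s 0) i (nmem s1 3) (nmem s1 4) (rmem s1 0)" using I by blast
    \<comment> \<open>Only \<open>i < n\<close> vertices have been eliminated, so some vertex is
      left and Dirac's theorem with the empty clique supplies a candidate.\<close>
    have "remaining n (nmem s1 3) \<noteq> {}"
    proof
      assume empty: "remaining n (nmem s1 3) = {}"
      have dead: "\<forall>v<n. nmem s1 3 v = 0 \<longleftrightarrow> v \<notin> nmem s1 4 ` {..<i}"
        using el unfolding elimination_def by (elim conjE)
      have "x \<in> nmem s1 4 ` {..<i}" if x: "x < n" for x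
      proof (rule ccontr)
        assume "x \<notin> nmem s1 4 ` {..<i}"
        then have "x \<in> remaining n (nmem s1 3)" using dead x by simp
        then show False unfolding empty by simp
      qed
      then have "{..<n} \<subseteq> nmem s1 4 ` {..<i}" by auto
      then have "n \<le> i"
        by (metis card_lessThan finite_lessThan surj_card_le)
      then show False using i by simp
    qed
    then obtain v where v: "simplicial E (remaining n (nmem s1 3)) v"
      using simplicial_vertex_outside_clique[OF chordal, of "remaining n (nmem s1 3)" "{}"]
      by (auto simp: clique_def)
    show "run n (Seq find_simplicial (Seq (NAssign 4 (var 6) (var 11))
       (Seq (NAssign 3 (var 11) (NConst 1)) reduce_weights))) s1
      (\<lambda>s'. nmem s' 6 0 = i \<and> nmem s' 0 0 = n \<and> ?I (Suc i) (set_nat 6 0 (Suc i) s'))"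
    proof (rule run_Seq, rule run_mono[OF run_find_simplicial[OF conjunct1[OF I] v]], intro run_Seq run_NAssign)
      fix s2 assume s2: "frame {7, 8, 9, 10, 11} s1 s2 \<and>
        simplicial E (remaining n (nmem s1 3)) (nmem s2 11 0)"
      define f where "f = nmem s2 11 0"
      have f: "f < n" using s2 by (auto simp: f_def simplicial_def)
      have s2': "loaded n E s2" "nmem s2 6 0 = i" "nmem s2 3 = nmem s1 3" "nmem s2 4 = nmem s1 4"
        "nmem s2 5 = nmem s1 5" "rmem s2 = rmem s1" "outp s2 = outp s1"
        using s2 I i loaded_frame[of n E s1 "{7, 8, 9, 10, 11}" s2] by (auto simp: frame_def)
      define s3 where "s3 = set_nat 3 f 1 (set_nat 4 i f s2)"
      have step: "elimination n E (rmem s 0) (Suc i) (nmem s3 3) (nmem s3 4)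
          (reduced n E (nmem s3 3) f (rmem s3 0))"
        using elimination_step[OF el, of f] s2 s2' by (simp add: s3_def f_def)
      have s3: "loaded n E s3" "nmem s3 11 0 = f" "0 < nmem s3 3 f"
        using s2' by (simp_all add: s3_def f_def)
      have "run n reduce_weights s3
        (\<lambda>s'. nmem s' 6 0 = i \<and> nmem s' 0 0 = n \<and> ?I (Suc i) (set_nat 6 0 (Suc i) s'))"
      proof (rule run_mono[OF run_reduce_weights[OF s3(1,2) f s3(3)]])
        fix s4 :: ram_state assume s4: "(\<forall>a. a \<noteq> 7 \<longrightarrow> nmem s4 a = nmem s3 a) \<and> outp s4 = outp s3 \<and>
          rmem s4 0 = reduced n E (nmem s3 3) f (rmem s3 0)"
        then have "loaded n E s4" using s3(1) by (simp add: loaded_def)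
        then show "nmem s4 6 0 = i \<and> nmem s4 0 0 = n \<and> ?I (Suc i) (set_nat 6 0 (Suc i) s4)"
          using s4 step s2' I by (simp add: loaded_size) (simp add: s3_def loaded_size)
      qed
      then show "run n reduce_weights
          (set_nat 3 (nval (var 11) (set_nat 4 (nval (var 6) s2) (nval (var 11) s2) s2))
            (nval (NConst 1) (set_nat 4 (nval (var 6) s2) (nval (var 11) s2) s2))
            (set_nat 4 (nval (var 6) s2) (nval (var 11) s2) s2))
        (\<lambda>s'. nmem s' 6 0 = i \<and> nmem s' 0 0 = n \<and> ?I (Suc i) (set_nat 6 0 (Suc i) s'))"
        using s2' by (simp add: s3_def f_def)
    qed
  qed (use s dead in \<open>auto simp: loaded_size elimination_def\<close>)
qed

subsection \<open>Selecting the independent set\<close>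

definition select_vertices :: com where
  "select_vertices = for_loop 6
     (Seq (NAssign 7 (NConst 0) (NCell 4 (NSub (NSub (var 0) (NConst 1)) (var 6))))
     (Seq (If (RLess RZero (RCell 0 (var 7))) (NAssign 10 (NConst 0) (NConst 1)) (NAssign 10 (NConst 0) (NConst 0)))
     (Seq (for_loop 8 (If (BAnd (is_set (NCell 5 (var 8))) (adjacent (var 7) (var 8)))
            (NAssign 10 (NConst 0) (NConst 0)) Skip))
       (NAssign 5 (var 7) (var 10)))))"

definition selection ::
  "nat \<Rightarrow> nat set set \<Rightarrow> (nat \<Rightarrow> nat) \<Rightarrow> (nat \<Rightarrow> real) \<Rightarrow> nat \<Rightarrow> (nat \<Rightarrow> nat) \<Rightarrow> bool" where
  "selection n E ord r i sel \<longleftrightarrow>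
     (\<forall>u. 0 < sel u \<longrightarrow> u \<in> ord ` {n - i..<n}) \<and>
     (\<forall>k<n. n - i \<le> k \<longrightarrow> (0 < sel (ord k) \<longleftrightarrow>
       0 < r (ord k) \<and> \<not> (\<exists>u<n. 0 < sel u \<and> {ord k, u} \<in> E \<and> u \<notin> ord ` {..k})))"

lemma selection_step:
  assumes inj: "inj_on ord {..<n}" and sel: "selection n E ord r i sel"
    and i: "i < n" and v: "v = ord (n - 1 - i)"
    and b: "0 < b \<longleftrightarrow> 0 < r v \<and> \<not> (\<exists>u<n. 0 < sel u \<and> {v, u} \<in> E)"
  shows "selection n E ord r (Suc i) (sel(v := b))"
proof -
  define k0 where "k0 = n - Suc i"
  have k0: "n - i = Suc k0" "k0 < n" "v = ord k0" "n - Suc i = k0" using i v by (auto simp: k0_def)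
  have sel1: "u \<in> ord ` {Suc k0..<n}" if "0 < sel u" for u
    using sel that k0 by (simp add: selection_def)
  have sel2: "0 < sel (ord k) \<longleftrightarrow>
       0 < r (ord k) \<and> \<not> (\<exists>u<n. 0 < sel u \<and> {ord k, u} \<in> E \<and> u \<notin> ord ` {..k})" if "k < n" "k0 < k" for k
    using sel that k0 by (simp add: selection_def)
  have eq: "ord a = ord b \<longleftrightarrow> a = b" if "a < n" "b < n" for a b
    using inj that by (auto dest: inj_onD)
  have sel3: "u \<notin> ord ` {..k0}" if "0 < sel u" for u
    using sel1[OF that] eq k0(2) by auto
  have "u \<in> ord ` {k0..<n}" if "0 < (sel(v := b)) u" for u
  proof (cases "u = v")
    case False
    then have "u \<in> ord ` {Suc k0..<n}" using sel1 that by simp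
    then show ?thesis by auto
  qed (use k0 in auto)
  moreover have "0 < (sel(v := b)) (ord k) \<longleftrightarrow> 0 < r (ord k) \<and>
      \<not> (\<exists>u<n. 0 < (sel(v := b)) u \<and> {ord k, u} \<in> E \<and> u \<notin> ord ` {..k})"
    if k: "k < n" "k0 \<le> k" for k
  proof -
    \<comment> \<open>The new vertex precedes or equals \<open>ord k\<close>, so the change at
      \<open>v\<close> is invisible to the blocking condition of \<open>ord k\<close>.\<close>
    have "v \<in> ord ` {..k}" using k k0 by simp
    then have *: "(\<exists>u<n. 0 < (sel(v := b)) u \<and> {ord k, u} \<in> E \<and> u \<notin> ord ` {..k}) \<longleftrightarrow>
        (\<exists>u<n. 0 < sel u \<and> {ord k, u} \<in> E \<and> u \<notin> ord ` {..k})"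
      by (metis fun_upd_other)
    show ?thesis
    proof (cases "k = k0")
      case True
      have "(\<exists>u<n. 0 < sel u \<and> {ord k0, u} \<in> E \<and> u \<notin> ord ` {..k0}) \<longleftrightarrow>
          (\<exists>u<n. 0 < sel u \<and> {v, u} \<in> E)"
        unfolding k0(3) using sel3 by blast
      then show ?thesis unfolding * unfolding True using b k0(3) by simp
    next
      case False
      then show ?thesis unfolding * using sel2[of k] k k0 eq[of k k0] by simp
    qed
  qed
  ultimately show ?thesis using k0 by (simp add: selection_def)
qed

lemma run_select_vertices:
  assumes s: "loaded n E s" "nmem s 5 = (\<lambda>_. 0)"
    and ord: "inj_on (nmem s 4) {..<n}" "nmem s 4 ` {..<n} \<subseteq> {..<n}"
  shows "run n select_vertices s (\<lambda>s'. frame {5, 6, 7, 8, 10} s s' \<and>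
    selection n E (nmem s 4) (rmem s 0) n (nmem s' 5))"
proof -
  let ?I = "\<lambda>i s'. frame {5, 6, 7, 8, 10} s s' \<and> selection n E (nmem s 4) (rmem s 0) i (nmem s' 5)"
  let ?flag = "If (RLess RZero (RCell 0 (var 7))) (NAssign 10 (NConst 0) (NConst 1)) (NAssign 10 (NConst 0) (NConst 0))"
  let ?loop = "for_loop 8 (If (BAnd (is_set (NCell 5 (var 8))) (adjacent (var 7) (var 8)))
            (NAssign 10 (NConst 0) (NConst 0)) Skip)"
  let ?rest = "Seq ?flag (Seq ?loop (NAssign 5 (var 7) (var 10)))"
  show ?thesis
    unfolding select_vertices_def
  proof (rule run_for_loop[where I = ?I])
    fix i s1 assume I: "?I i s1" and i: "nmem s1 6 0 = i" "nmem s1 0 0 = n" "i < n"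
    define v where "v = nmem s 4 (n - 1 - i)"
    have v: "v < n" using ord(2) i unfolding v_def by (simp add: image_subset_iff)
    let ?Q = "\<lambda>s'. nmem s' 6 0 = i \<and> nmem s' 0 0 = n \<and> ?I (Suc i) (set_nat 6 0 (Suc i) s')"
    define s2 where "s2 = set_nat 7 0 v s1"
    have s2: "frame {5, 6, 7, 8, 10} s s2" "nmem s2 7 0 = v" "nmem s2 6 0 = i" "nmem s2 5 = nmem s1 5"
      using I i by (auto simp: s2_def)
    \<comment> \<open>Only the positivity of the initial flag matters, so both branches that set it
      are handled together through \<open>c\<close>.\<close>
    have loop: "run n (Seq ?loop (NAssign 5 (var 7) (var 10))) (set_nat 10 0 c s2) ?Q"
      if c: "0 < c \<longleftrightarrow> 0 < rmem s 0 v" for c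
    proof -
      let ?s3 = "set_nat 10 0 c s2"
      have s3: "frame {5, 6, 7, 8, 10} s ?s3" using s2 by simp
      show ?thesis
      proof (rule run_Seq, rule run_mono[OF run_flag_loop[where P = "\<lambda>u. 0 < nmem s1 5 u \<and> {v, u} \<in> E"]])
        fix s4 j assume j: "j < n" "frame {8, 10} ?s3 s4" "nmem s4 8 0 = j"
        have "frame {5, 6, 7, 8, 10} s s4"
          by (rule frame_trans[of _ s ?s3 "{8, 10}"]) (use s3 j in auto)
        then have "loaded n E s4" "nmem s4 7 0 = v" "nmem s4 5 = nmem s1 5"
          using loaded_frame[OF s(1), of "{5, 6, 7, 8, 10}" s4] s2 j by (simp_all add: frame_def)
        then show "bval (BAnd (is_set (NCell 5 (var 8))) (adjacent (var 7) (var 8))) s4 \<longleftrightarrow>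
          0 < nmem s1 5 j \<and> {v, j} \<in> E"
          using j v by (simp add: bval_adjacent)
      next
        fix s4 assume s4: "frame {8, 10} ?s3 s4 \<and> (0 < nmem s4 10 0 \<longleftrightarrow>
          0 < nmem ?s3 10 0 \<and> (\<forall>u<n. \<not> (0 < nmem s1 5 u \<and> {v, u} \<in> E)))"
        have "frame {5, 6, 7, 8, 10} s s4"
          by (rule frame_trans[of _ s ?s3 "{8, 10}"]) (use s3 s4 in auto)
        moreover have "nmem s4 7 0 = v" "nmem s4 6 0 = i" "nmem s4 5 = nmem s1 5" "nmem s4 0 0 = n"
          using s2 s4 i by (auto simp: frame_def s2_def)
        moreover have "selection n E (nmem s 4) (rmem s 0) (Suc i) ((nmem s1 5)(v := nmem s4 10 0))"
          using I i s4 c by (intro selection_step[OF ord(1)]) (auto simp: v_def)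
        ultimately show "run n (NAssign 5 (var 7) (var 10)) s4 ?Q"
          by (intro run_NAssign) simp
      qed (use s2 i in \<open>auto simp: s2_def\<close>)
    qed
    have "run n ?rest s2 ?Q"
      using loop[of 1] loop[of 0] s2
      by (intro run_Seq[of n ?flag] run_If run_NAssign) (auto simp: frame_def)
    moreover have "nval (NCell 4 (NSub (NSub (var 0) (NConst 1)) (var 6))) s1 = v"
      using I i by (simp add: v_def frame_def)
    ultimately show "run n (Seq (NAssign 7 (NConst 0) (NCell 4 (NSub (NSub (var 0) (NConst 1)) (var 6)))) ?rest) s1 ?Q"
      by (intro run_Seq[of n "NAssign 7 _ _"] run_NAssign) (simp add: s2_def)
  qed (use s in \<open>auto simp: loaded_size selection_def\<close>)
qed

subsection \<open>Writing the design\<close>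

text \<open>Two passes are needed because the number of interventions comes first in the encoding
  and output cannot be revised.\<close>

definition write_design :: com where
  "write_design = Seq (NAssign 11 (NConst 0) (NConst 0))
     (Seq (for_loop 7 (If (is_set (NCell 5 (var 7))) Skip (NAssign 11 (NConst 0) (NAdd (var 11) (NConst 1)))))
     (Seq (Output (var 11))
       (for_loop 7 (If (is_set (NCell 5 (var 7))) Skip (Seq (Output (NConst 1)) (Output (var 7)))))))"

definition complement_singletons :: "nat \<Rightarrow> (nat \<Rightarrow> nat) \<Rightarrow> nat list list" where
  "complement_singletons n sel = map (\<lambda>v. [v]) (filter (\<lambda>v. sel v = 0) [0..<n])"

lemma run_write_design:
  assumes "nmem s 0 0 = n" "outp s = []"
  shows "run n write_design s (\<lambda>s'. outp s' = encode_design (complement_singletons n (nmem s 5)))"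
proof -
  let ?sel = "nmem s 5"
  let ?I = "\<lambda>i (s' :: ram_state). nmem s' 5 = ?sel \<and> outp s' = [] \<and> nmem s' 11 0 = length (filter (\<lambda>v. ?sel v = 0) [0..<i])"
  let ?J = "\<lambda>i (s' :: ram_state). nmem s' 5 = ?sel \<and> outp s' = length (complement_singletons n ?sel) #
    concat (map (\<lambda>xs. length xs # xs) (complement_singletons i ?sel))"
  have "run n (Seq (Output (var 11))
      (for_loop 7 (If (is_set (NCell 5 (var 7))) Skip (Seq (Output (NConst 1)) (Output (var 7)))))) s'
    (\<lambda>s'. outp s' = encode_design (complement_singletons n ?sel))"
    if "?I n s'" "nmem s' 0 0 = n" for s'
    by (rule run_Seq, rule run_Output, rule run_for_loop[where I = ?J])
      (use that in \<open>auto intro!: run_If run_Skip run_Seq run_Output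
        simp: complement_singletons_def encode_design_def\<close>)
  then show ?thesis
    unfolding write_design_def
    by (intro run_Seq[of n "NAssign _ _ _"] run_Seq[of n "for_loop _ _"] run_NAssign run_for_loop[where I = ?I])
      (use assms in \<open>auto intro!: run_If run_Skip run_NAssign\<close>)
qed

subsection \<open>Correctness\<close>

definition design_program :: com where
  "design_program = Seq check_costs (If (is_set (var 10))
     (Seq row_offsets (Seq eliminate (Seq select_vertices write_design))) Skip)"

lemma min_cost_complement_singletons:
  assumes E: "simple_graph {..<n} E" "chordal E" and w: "\<forall>v<n. 0 \<le> w v"
    and el: "elimination n E w n dead ord r" and sel: "selection n E ord r n sel"
  shows "min_cost_design {..<n} E w (map set (complement_singletons n sel))"
proof -
  let ?S = "{v. 0 < sel v}"
  have edges: "\<forall>e\<in>E. card e = 2" using E(1) by (simp add: simple_graph_def)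
  \<comment> \<open>An injective map of a finite set into itself is onto, so after \<open>n\<close>
    rounds \<open>ord\<close> enumerates all vertices.\<close>
  have inj: "inj_on ord {..<n}" and ran: "ord ` {..<n} = {..<n}"
    and later: "\<And>k. k < n \<Longrightarrow> clique E {u \<in> {..<n}. {ord k, u} \<in> E \<and> u \<notin> ord ` {..k}}"
    and r: "\<And>v. v \<in> {..<n} \<Longrightarrow> r v = w v -
        (\<Sum>j<n. if {ord j, v} \<in> E \<and> v \<notin> ord ` {..j} then max 0 (r (ord j)) else 0)"
    using el endo_inj_surj[of "{..<n}" ord] by (auto simp: elimination_def)
  have S: "?S \<subseteq> {..<n}"
    using sel ran by (simp add: selection_def atLeast0LessThan subset_iff)
  have S': "ord k \<in> ?S \<longleftrightarrow> 0 < r (ord k) \<and> \<not> (\<exists>u\<in>?S. {ord k, u} \<in> E \<and> u \<notin> ord ` {..k})"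
    if "k < n" for k
    using sel that S unfolding selection_def by auto
  have indep: "independent_set E ?S"
    by (rule frank_max_weight(1)[OF edges inj ran later r S S'])
  show ?thesis
    unfolding complement_singletons_def
  proof (rule min_cost_design_singletons[OF E _ S indep])
    show "sum w T \<le> sum w ?S" if "T \<subseteq> {..<n}" "independent_set E T" for T
      by (rule frank_max_weight(2)[OF edges inj ran later r S S' that])
  qed (use w in auto)
qed

lemma run_design_program:
  assumes E: "simple_graph {..<n} E" "chordal E"
  shows "run n design_program (input_state n E w) (\<lambda>s.
    if \<forall>v<n. 0 \<le> w v
    then \<exists>xss. min_cost_design {..<n} E w (map set xss) \<and> outp s = encode_design xss
    else outp s = [])"
proof -
  let ?s0 = "input_state n E w"
  let ?Q = "\<lambda>s. if \<forall>v<n. 0 \<le> w v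
    then \<exists>xss. min_cost_design {..<n} E w (map set xss) \<and> outp s = encode_design xss
    else outp s = []"
  have edges: "\<forall>e\<in>E. card e = 2" using E(1) by (simp add: simple_graph_def)
  have matrix: "0 < nmem ?s0 1 (u * n + v) \<longleftrightarrow> {u, v} \<in> E" if "u < n" "v < n" for u v
  proof -
    have "(u * n + v) div n = u" "(u * n + v) mod n = v" using that by auto
    moreover have "u * n + v < n * n"
    proof -
      have "u * n + v < Suc u * n" using that by simp
      also have "\<dots> \<le> n * n" using that by (intro mult_le_mono1) simp
      finally show ?thesis .
    qed
    ultimately show ?thesis by (simp add: input_state_def)
  qed
  have pos: "run n (Seq row_offsets (Seq eliminate (Seq select_vertices write_design))) s1 ?Q"
    if s1: "frame {7, 10} ?s0 s1" and w: "\<forall>v<n. 0 \<le> w v" for s1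
  proof (rule run_Seq, rule run_mono[OF run_row_offsets])
    show "nmem s1 0 0 = n" "nmem s1 2 0 = 0" using s1 by (auto simp: frame_def input_state_def)
    fix s2 assume s2: "frame {2, 7} s1 s2 \<and> (\<forall>u<n. nmem s2 2 u = u * n)"
    then have fr: "frame {2, 7, 10} ?s0 s2" using s1 by (auto simp: frame_def)
    have loaded: "loaded n E s2"
      using s2 fr matrix by (simp add: loaded_def frame_nmem) (simp add: input_state_def)
    have s2': "nmem s2 3 = (\<lambda>_. 0)" "nmem s2 5 = (\<lambda>_. 0)" "outp s2 = []"
        "rmem s2 0 = (\<lambda>v. if v < n then w v else 0)"
      using fr by (auto simp: frame_def input_state_def)
    show "run n (Seq eliminate (Seq select_vertices write_design)) s2 ?Q"
    proof (rule run_Seq, rule run_mono[OF run_eliminate[OF loaded s2'(1) E(2) edges]])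
      fix s3 assume s3: "loaded n E s3 \<and> nmem s3 5 = nmem s2 5 \<and> outp s3 = outp s2 \<and>
        elimination n E (rmem s2 0) n (nmem s3 3) (nmem s3 4) (rmem s3 0)"
      then have el: "elimination n E w n (nmem s3 3) (nmem s3 4) (rmem s3 0)"
        using s2'(4) by (simp add: elimination_def)
      show "run n (Seq select_vertices write_design) s3 ?Q"
      proof (rule run_Seq, rule run_mono[OF run_select_vertices])
        fix s4 assume s4: "frame {5, 6, 7, 8, 10} s3 s4 \<and>
          selection n E (nmem s3 4) (rmem s3 0) n (nmem s4 5)"
        then have "min_cost_design {..<n} E w (map set (complement_singletons n (nmem s4 5)))"
          using min_cost_complement_singletons[OF E w el] by blast
        moreover have "nmem s4 0 0 = n" "outp s4 = []"
          using s3 s4 s2' by (auto simp: frame_def loaded_size)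
        ultimately show "run n write_design s4 ?Q"
          using w by (intro run_mono[OF run_write_design]) auto
      qed (use s3 s2' el in \<open>auto simp: elimination_def\<close>)
    qed
  qed
  have size: "nmem ?s0 0 0 = n" by (simp add: input_state_def)
  show ?thesis
    unfolding design_program_def
  proof (rule run_Seq, rule run_mono[OF run_check_costs[OF size]])
    fix s1 assume s1: "frame {7, 10} ?s0 s1 \<and> (0 < nmem s1 10 0 \<longleftrightarrow> (\<forall>v<n. 0 \<le> rmem ?s0 0 v))"
    then have "0 < nmem s1 10 0 \<longleftrightarrow> (\<forall>v<n. 0 \<le> w v)"
      by (simp add: input_state_def)
    then show "run n (If (is_set (var 10))
        (Seq row_offsets (Seq eliminate (Seq select_vertices write_design))) Skip) s1 ?Q"
      using s1 pos[of s1]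
      by (intro run_If run_Skip) (auto simp: frame_def input_state_def)
  qed
qed

theorem mainTheorem2:
  shows "\<exists>(prog :: com) (p :: nat poly).
    \<forall>(n :: nat) (E :: nat set set) (w :: nat \<Rightarrow> real).
      simple_graph {..<n} E \<and> chordal E \<longrightarrow>
      (\<exists>t s. exec prog (input_state n E w) t s \<and> t \<le> poly p n \<and>
         (if \<exists>Is. min_cost_design {..<n} E w Is
          then \<exists>xss. min_cost_design {..<n} E w (map set xss) \<and> outp s = encode_design xss
          else outp s = [])) \<and>
      ((\<forall>v<n. 0 \<le> w v) \<longrightarrow> (\<exists>Is. min_cost_design {..<n} E w Is))"
proof (intro exI allI impI)
  fix n :: nat and E :: "nat set set" and w :: "nat \<Rightarrow> real"
  assume E: "simple_graph {..<n} E \<and> chordal E"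
  obtain t s where ts: "exec design_program (input_state n E w) t s"
      "t \<le> poly (time_poly design_program) n"
      "if \<forall>v<n. 0 \<le> w v
       then \<exists>xss. min_cost_design {..<n} E w (map set xss) \<and> outp s = encode_design xss
       else outp s = []"
    using run_design_program[of n E w] E unfolding run_def by blast
  \<comment> \<open>For nonnegative costs the run itself exhibits an optimal design, so the sign
    test made by the program decides exactly whether an optimum exists.\<close>
  have iff: "(\<exists>Is. min_cost_design {..<n} E w Is) \<longleftrightarrow> (\<forall>v<n. 0 \<le> w v)"
    using ts(3) min_cost_design_imp_nonneg[of "{..<n}" E w] by (metis lessThan_iff)
  show "(\<exists>t s. exec design_program (input_state n E w) t s \<and>
         t \<le> poly (time_poly design_program) n \<and>
         (if \<exists>Is. min_cost_design {..<n} E w Is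
          then \<exists>xss. min_cost_design {..<n} E w (map set xss) \<and> outp s = encode_design xss
          else outp s = [])) \<and>
      ((\<forall>v<n. 0 \<le> w v) \<longrightarrow> (\<exists>Is. min_cost_design {..<n} E w Is))"
    unfolding iff using ts by blast
qed

end
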